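(* Let $m\ge1$, $n\ge0$ and $\mathcal T=\{(x,\xi):0\le\xi\le x\le1\}$. Consider the following system of equations on $\mathcal T$ for unknowns $K=(K_{ij})_{1\le i\le m,1\le j\le n}$ and $L=(L_{ij})_{1\le i,j\le m}$: $$\mu_i\partial_xK_{ij}-\lambda_j\partial_\xi K_{ij}=\sum_{k=1}^n\sigma^{++}_{kj}K_{ik}+\sum_{p=1}^m\sigma^{-+}_{pj}L_{ip}\qquad(1\le i\le m,\ 1\le j\le n),$$ $$\mu_i\partial_xL_{ij}+\mu_j\partial_\xi L_{ij}=\sum_{p=1}^m\sigma^{--}_{pj}L_{ip}+\sum_{k=1}^n\sigma^{+-}_{kj}K_{ik}\qquad(1\le i,j\le m),$$ with boundary conditions $$K_{ij}(x,x)=k_{ij}:=-\frac{\sigma^{-+}_{ij}}{\mu_i+\lambda_j}\quad(1\le i\le m,\ 1\le j\le n),\qquad L_{ij}(x,x)=l_{ij}:=-\frac{\sigma^{--}_{ij}}{\mu_i-\mu_j}\quad(1\le i,j\le m,\ i\neq j),$$ $$\mu_jL_{ij}(x,0)=\sum_{k=1}^n\lambda_kK_{ik}(x,0)q_{kj}\quad(1\le i\le j\le m),\qquad L_{ij}(1,\xi)=l_{ij}\quad(1\le j<i\le m).$$ Then there exists a unique solution $(K,L)$ with $K$ and $L$ in $L^\infty(\mathcal T)$. Moreover, all the boundary traces of $K$ and $L$ (on $\xi=0$, on $x=1$ and on $\xi=x$) are functions in $L^\infty(0,1)$.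
   Context: The constants satisfy $-\mu_1<\dots<-\mu_m<0<\lambda_1\le\dots\le\lambda_n$; $\sigma^{++}_{ij}$ ($1\le i,j\le n$), $\sigma^{+-}_{ij}$ ($1\le i\le n,1\le j\le m$), $\sigma^{-+}_{ij}$ ($1\le i\le m,1\le j\le n$), $\sigma^{--}_{ij}$ ($1\le i,j\le m$), $q_{ij}$ ($1\le i\le n,1\le j\le m$) are real constants. Standing assumption: $\sigma^{--}_{jj}=0$ for all $j$. Empty sums are zero. Notion of solution. Solutions are understood in the sense of integration along characteristics: $K_{ij},L_{ij}$ are bounded (Borel) measurable functions on $\mathcal T$ such that for all $(x,\xi)\in\mathcal T$: $$K_{ij}(x,\xi)=k_{ij}+\int_0^{s^F_{ij}}\Big[\sum_{k}\sigma^{++}_{kj}K_{ik}+\sum_p\sigma^{-+}_{pj}L_{ip}\Big](x-\mu_is,\ \xi+\lambda_js)\,ds,\qquad s_{ij}^F=\frac{x-\xi}{\mu_i+\lambda_j},$$ $$L_{ij}(x,\xi)=b_{ij}(x,\xi)-\epsilon_{ij}\int_0^{\nu^F_{ij}}\Big[\sum_p\sigma^{--}_{pj}L_{ip}+\sum_k\sigma^{+-}_{kj}K_{ik}\Big](x+\epsilon_{ij}\mu_i\nu,\ \xi+\epsilon_{ij}\mu_j\nu)\,d\nu,$$ where $\epsilon_{ij}=1$ if $i>j$ and $\epsilon_{ij}=-1$ otherwise; $\nu^F_{ij}=\nu^F_{ij}(x,\xi)\ge 0$ is the time at which the line $\nu\mapsto(x+\epsilon_{ij}\mu_i\nu,\xi+\epsilon_{ij}\mu_j\nu)$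 reaches the part of $\partial\mathcal T$ carrying boundary data, namely $\nu_{ij}^F=\min\{\frac{1-x}{\mu_i},\frac{x-\xi}{\mu_j-\mu_i}\}$ if $i>j$, $\nu_{ii}^F=\frac{\xi}{\mu_i}$, and $\nu^F_{ij}=\min\{\frac{\xi}{\mu_j},\frac{x-\xi}{\mu_i-\mu_j}\}$ if $i<j$; and $b_{ij}(x,\xi)$ is the prescribed boundary value at the end point: $b_{ij}=l_{ij}$ if $i>j$, or if $i<j$ and $\mu_i\xi-\mu_jx>0$ (end point on $\xi=x$ or $x=1$), and $b_{ij}=\frac1{\mu_j}\sum_{r=1}^n\lambda_rq_{rj}K_{ir}(x-\mu_i\nu_{ij}^F,0)$ if $i=j$, or if $i<j$ and $\mu_i\xi-\mu_jx\le0$ (end point on $\xi=0$). *)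

theory Defs
  imports "HOL-Analysis.Analysis"
begin

text \<open>
  Indices are natural numbers starting from 1: \<open>i \<in> {1..m}\<close> for the speeds \<open>-\<mu> i\<close> and
  \<open>j \<in> {1..n}\<close> for the speeds \<open>lam j\<close>; nothing is required of values outside these ranges.
  The superscripts \<open>++\<close>, \<open>+-\<close>, \<open>-+\<close>, \<open>--\<close> of the coupling constants \<open>\<sigma>\<close> are written
  \<open>pp\<close>, \<open>pm\<close>, \<open>mp\<close>, \<open>mm\<close>.
\<close>

definition tri_dom :: "(real \<times> real) set" where
  "tri_dom = {(x, \<xi>). 0 \<le> \<xi> \<and> \<xi> \<le> x \<and> x \<le> 1}"

definition k_data :: "(nat \<Rightarrow> real) \<Rightarrow> (nat \<Rightarrow> real) \<Rightarrow> (nat \<Rightarrow> nat \<Rightarrow> real) \<Rightarrow> nat \<Rightarrow> nat \<Rightarrow> real" where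
  "k_data \<mu> lam \<sigma>mp i j = - \<sigma>mp i j / (\<mu> i + lam j)"

definition l_data :: "(nat \<Rightarrow> real) \<Rightarrow> (nat \<Rightarrow> nat \<Rightarrow> real) \<Rightarrow> nat \<Rightarrow> nat \<Rightarrow> real" where
  "l_data \<mu> \<sigma>mm i j = - \<sigma>mm i j / (\<mu> i - \<mu> j)"

definition K_source ::
    "nat \<Rightarrow> nat \<Rightarrow> (nat \<Rightarrow> nat \<Rightarrow> real) \<Rightarrow> (nat \<Rightarrow> nat \<Rightarrow> real) \<Rightarrow>
     (nat \<Rightarrow> nat \<Rightarrow> real \<times> real \<Rightarrow> real) \<Rightarrow> (nat \<Rightarrow> nat \<Rightarrow> real \<times> real \<Rightarrow> real) \<Rightarrow>
     nat \<Rightarrow> nat \<Rightarrow> real \<times> real \<Rightarrow> real" where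
  "K_source m n \<sigma>pp \<sigma>mp K L i j z =
     (\<Sum>k=1..n. \<sigma>pp k j * K i k z) + (\<Sum>p=1..m. \<sigma>mp p j * L i p z)"

definition L_source ::
    "nat \<Rightarrow> nat \<Rightarrow> (nat \<Rightarrow> nat \<Rightarrow> real) \<Rightarrow> (nat \<Rightarrow> nat \<Rightarrow> real) \<Rightarrow>
     (nat \<Rightarrow> nat \<Rightarrow> real \<times> real \<Rightarrow> real) \<Rightarrow> (nat \<Rightarrow> nat \<Rightarrow> real \<times> real \<Rightarrow> real) \<Rightarrow>
     nat \<Rightarrow> nat \<Rightarrow> real \<times> real \<Rightarrow> real" where
  "L_source m n \<sigma>mm \<sigma>pm K L i j z =
     (\<Sum>p=1..m. \<sigma>mm p j * L i p z) + (\<Sum>k=1..n. \<sigma>pm k j * K i k z)"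

definition s_end :: "(nat \<Rightarrow> real) \<Rightarrow> (nat \<Rightarrow> real) \<Rightarrow> nat \<Rightarrow> nat \<Rightarrow> real \<Rightarrow> real \<Rightarrow> real" where
  "s_end \<mu> lam i j x \<xi> = (x - \<xi>) / (\<mu> i + lam j)"

text \<open>
  Orientation in which the characteristic line of \<open>L i j\<close>, with direction \<open>(\<mu> i, \<mu> j)\<close>, is
  followed to the boundary of the triangle, and the time at which the part of the boundary
  carrying data is reached.  As \<open>\<mu>\<close> is decreasing, \<open>\<mu> j - \<mu> i > 0\<close> for \<open>i > j\<close>.
\<close>

definition orient :: "nat \<Rightarrow> nat \<Rightarrow> real" where
  "orient i j = (if i > j then 1 else - 1)"

definition nu_end :: "(nat \<Rightarrow> real) \<Rightarrow> nat \<Rightarrow> nat \<Rightarrow> real \<Rightarrow> real \<Rightarrow> real" where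
  "nu_end \<mu> i j x \<xi> =
     (if i > j then min ((1 - x) / \<mu> i) ((x - \<xi>) / (\<mu> j - \<mu> i))
      else if i = j then \<xi> / \<mu> i
      else min (\<xi> / \<mu> j) ((x - \<xi>) / (\<mu> i - \<mu> j)))"

text \<open>
  Boundary value at the end point: constant data if it lies on \<open>\<xi> = x\<close> or \<open>x = 1\<close>, and
  otherwise, on \<open>\<xi> = 0\<close>, the value obtained from \<open>\<mu> j * L i j (x, 0) = (\<Sum>r=1..n. lam r * K i r (x, 0) * q r j)\<close>.
\<close>

definition L_boundary ::
    "nat \<Rightarrow> (nat \<Rightarrow> real) \<Rightarrow> (nat \<Rightarrow> real) \<Rightarrow> (nat \<Rightarrow> nat \<Rightarrow> real) \<Rightarrow> (nat \<Rightarrow> nat \<Rightarrow> real) \<Rightarrow>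
     (nat \<Rightarrow> nat \<Rightarrow> real \<times> real \<Rightarrow> real) \<Rightarrow> nat \<Rightarrow> nat \<Rightarrow> real \<Rightarrow> real \<Rightarrow> real" where
  "L_boundary n \<mu> lam \<sigma>mm q K i j x \<xi> =
     (if i > j \<or> (i < j \<and> \<mu> i * \<xi> - \<mu> j * x > 0) then l_data \<mu> \<sigma>mm i j
      else 1 / \<mu> j * (\<Sum>r=1..n. lam r * q r j * K i r (x - \<mu> i * nu_end \<mu> i j x \<xi>, 0)))"

definition bounded_borel_on :: "'a::topological_space set \<Rightarrow> ('a \<Rightarrow> real) \<Rightarrow> bool" where
  "bounded_borel_on S f \<longleftrightarrow> f \<in> borel_measurable (restrict_space borel S) \<and> bounded (f ` S)"

text \<open>
  Solution in the sense of integration along characteristics.  The values of \<open>K\<close> and \<open>L\<close>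
  outside the triangle are irrelevant: all characteristic segments stay inside it.
\<close>

definition char_solution ::
    "nat \<Rightarrow> nat \<Rightarrow> (nat \<Rightarrow> real) \<Rightarrow> (nat \<Rightarrow> real) \<Rightarrow>
     (nat \<Rightarrow> nat \<Rightarrow> real) \<Rightarrow> (nat \<Rightarrow> nat \<Rightarrow> real) \<Rightarrow> (nat \<Rightarrow> nat \<Rightarrow> real) \<Rightarrow> (nat \<Rightarrow> nat \<Rightarrow> real) \<Rightarrow>
     (nat \<Rightarrow> nat \<Rightarrow> real) \<Rightarrow>
     (nat \<Rightarrow> nat \<Rightarrow> real \<times> real \<Rightarrow> real) \<Rightarrow> (nat \<Rightarrow> nat \<Rightarrow> real \<times> real \<Rightarrow> real) \<Rightarrow> bool" where
  "char_solution m n \<mu> lam \<sigma>pp \<sigma>pm \<sigma>mp \<sigma>mm q K L \<longleftrightarrow>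
     (\<forall>i\<in>{1..m}. \<forall>j\<in>{1..n}. bounded_borel_on tri_dom (K i j)) \<and>
     (\<forall>i\<in>{1..m}. \<forall>j\<in>{1..m}. bounded_borel_on tri_dom (L i j)) \<and>
     (\<forall>i\<in>{1..m}. \<forall>j\<in>{1..n}. \<forall>(x, \<xi>)\<in>tri_dom.
        K i j (x, \<xi>) = k_data \<mu> lam \<sigma>mp i j +
          (LBINT s:{0..s_end \<mu> lam i j x \<xi>}.
             K_source m n \<sigma>pp \<sigma>mp K L i j (x - \<mu> i * s, \<xi> + lam j * s))) \<and>
     (\<forall>i\<in>{1..m}. \<forall>j\<in>{1..m}. \<forall>(x, \<xi>)\<in>tri_dom.
        L i j (x, \<xi>) = L_boundary n \<mu> lam \<sigma>mm q K i j x \<xi> -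
          orient i j * (LBINT \<nu>:{0..nu_end \<mu> i j x \<xi>}.
             L_source m n \<sigma>mm \<sigma>pm K L i j
               (x + orient i j * \<mu> i * \<nu>, \<xi> + orient i j * \<mu> j * \<nu>)))"

definition Linf_on :: "real set \<Rightarrow> (real \<Rightarrow> real) set" where
  "Linf_on S = {f \<in> borel_measurable (restrict_space lborel S).
     \<exists>C. AE x in restrict_space lborel S. \<bar>f x\<bar> \<le> C}"

text \<open>
  Solutions are defined at every point of the closed triangle, so the traces on \<open>\<xi> = 0\<close>,
  \<open>x = 1\<close> and \<open>\<xi> = x\<close> are restrictions.
\<close>

definition traces_Linf :: "(real \<times> real \<Rightarrow> real) \<Rightarrow> bool" where
  "traces_Linf f \<longleftrightarrow>
     (\<lambda>x. f (x, 0)) \<in> Linf_on {0<..<1} \<and>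
     (\<lambda>\<xi>. f (1, \<xi>)) \<in> Linf_on {0<..<1} \<and>
     (\<lambda>x. f (x, x)) \<in> Linf_on {0<..<1}"

end

(*
  On the triangle the function x - theta * xi, with theta < 1 close to 1, decreases at a rate
  bounded away from 0 along every characteristic followed towards its boundary data: for K
  because x decreases and xi increases, for L_ij with i <= j because mu_i > theta * mu_j, and for
  L_ij with i > j, followed the other way, because mu_i < theta * mu_j once theta is close to 1.  With the
  weight exp (gamma * (x - theta * xi)), gamma large, all integral terms are small.  The boundary
  term on xi = 0 is bounded, involves only K, and is evaluated where the weight is not larger;
  measuring K on a finer scale than L makes it small too, so the right-hand side is a contraction.
*)
theory Submission imports Defs begin

text \<open>Two features fix the function space. For \<open>i < j\<close> the boundary value of
  \<open>L i j\<close> switches across the line \<open>\<mu> i * \<xi> = \<mu> j * x\<close> between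
  unrelated data, so continuity cannot be expected. The boundary term also evaluates
  \<open>K\<close> on the null set \<open>\<xi> = 0\<close>, so classes modulo null sets do not
  suffice. The space therefore consists of bounded Borel functions with a value at every point, and
  uniqueness is pointwise. The value \<open>\<theta> = 1\<close> is excluded because
  \<open>x - \<xi>\<close> is constant along the characteristics of \<open>L i i\<close>. A second
  scale is unavoidable: at points already on \<open>\<xi> = 0\<close> the boundary term is evaluated
  at the point itself, so no choice of \<open>\<gamma>\<close> shrinks it. The way out is triangular
  structure: this term involves \<open>K\<close> alone, while the boundary data of \<open>K\<close>
  are constants. Measuring \<open>K\<close> in units of \<open>1 / (4 * C)\<close> turns the factor
  \<open>C\<close> into \<open>1 / 4\<close>. In exchange the differences of \<open>L\<close> look
  \<open>4 * C\<close> times larger in the equation for \<open>K\<close>, but there they occur only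
  under integrals, and \<open>\<gamma> * c = 8 * C\<^sup>2\<close> absorbs the loss.\<close>

section \<open>A contraction principle for weighted sup-distances\<close>

text \<open>Off \<open>S\<close> the functions are unconstrained, so the weighted distance does not
  separate the elements of \<open>M\<close>, and Picard iteration is run pointwise on
  \<open>S\<close>. Accordingly \<open>closed\<close> asks for stability under every limit that is
  uniform on \<open>S\<close>, whatever its values elsewhere. The bound \<open>B\<close> turns
  weighted convergence into uniform convergence.\<close>

lemma weighted_contraction_fixpoint:
  fixes F :: "('a \<Rightarrow> real) \<Rightarrow> 'a \<Rightarrow> real" and W :: "'a \<Rightarrow> real"
  assumes "u0 \<in> M" and F: "\<And>u. u \<in> M \<Longrightarrow> F u \<in> M"
    and dist: "\<And>u v. u \<in> M \<Longrightarrow> v \<in> M \<Longrightarrow> \<exists>D\<ge>0. \<forall>z\<in>S. \<bar>u z - v z\<bar> \<le> D * W z"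
    and contr: "\<And>u v D. u \<in> M \<Longrightarrow> v \<in> M \<Longrightarrow> D \<ge> 0 \<Longrightarrow> \<forall>z\<in>S. \<bar>u z - v z\<bar> \<le> D * W z
          \<Longrightarrow> \<forall>z\<in>S. \<bar>F u z - F v z\<bar> \<le> D / 2 * W z"
    and closed: "\<And>U u. (\<And>k. U k \<in> M) \<Longrightarrow> uniform_limit S U u sequentially \<Longrightarrow> u \<in> M"
    and W: "\<And>z. z \<in> S \<Longrightarrow> 0 \<le> W z" "\<And>z. z \<in> S \<Longrightarrow> W z \<le> B"
  obtains u where "u \<in> M" "\<And>z. z \<in> S \<Longrightarrow> F u z = u z"
    "\<And>v z. v \<in> M \<Longrightarrow> (\<And>z. z \<in> S \<Longrightarrow> F v z = v z) \<Longrightarrow> z \<in> S \<Longrightarrow> v z = u z"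
proof -
  define U where "U k = (F ^^ k) u0" for k
  have UM: "U k \<in> M" for k
    by (induction k) (auto simp: U_def assms(1) F)
  have US: "U (Suc k) = F (U k)" for k by (simp add: U_def)
  obtain D where D: "D \<ge> 0" "\<forall>z\<in>S. \<bar>U 1 z - U 0 z\<bar> \<le> D * W z"
    using dist[OF UM UM] by blast
  have step: "\<forall>z\<in>S. \<bar>U (Suc k) z - U k z\<bar> \<le> D / 2 ^ k * W z" for k
  proof (induction k)
    case 0
    show ?case using D by simp
  next
    case (Suc k)
    have "\<forall>z\<in>S. \<bar>F (U (Suc k)) z - F (U k) z\<bar> \<le> D / 2 ^ k / 2 * W z"
      by (rule contr[OF UM UM _ Suc]) (use D in simp)
    then show ?case by (simp add: US field_simps)
  qed
  \<comment> \<open>The exact partial sum of the geometric series is what the induction on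
    \<open>l\<close> can carry; its bound \<open>2 * D / 2 ^ k\<close> would not reproduce
    itself.\<close>
  have cauchy: "\<bar>U (k + l) z - U k z\<bar> \<le> 2 * D * (1 / 2 ^ k - 1 / 2 ^ (k + l)) * W z" if "z \<in> S" for k l z
  proof (induction l)
    case 0
    show ?case by simp
  next
    case (Suc l)
    have "\<bar>U (Suc (k + l)) z - U (k + l) z\<bar> \<le> D / 2 ^ (k + l) * W z"
      using step that by blast
    then have "\<bar>U (k + Suc l) z - U k z\<bar>
        \<le> 2 * D * (1 / 2 ^ k - 1 / 2 ^ (k + l)) * W z + D / 2 ^ (k + l) * W z"
      using Suc by simp
    also have "\<dots> = 2 * D * (1 / 2 ^ k - 1 / 2 ^ (k + Suc l)) * W z"
      by (simp add: field_simps)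
    finally show ?case .
  qed
  have cauchy': "\<bar>U (k + l) z - U k z\<bar> \<le> 2 * D * B / 2 ^ k"
    and cauchyW: "\<bar>U (k + l) z - U k z\<bar> \<le> 2 * D / 2 ^ k * W z" if "z \<in> S" for k l z
  proof -
    have "2 * D * (1 / 2 ^ k - 1 / 2 ^ (k + l)) * W z \<le> 2 * D * (1 / 2 ^ k) * W z"
      using W(1)[OF that] D(1) by (intro mult_right_mono mult_left_mono) auto
    then show *: "\<bar>U (k + l) z - U k z\<bar> \<le> 2 * D / 2 ^ k * W z"
      using cauchy[OF that, of k l] by simp
    have "2 * D / 2 ^ k * W z \<le> 2 * D / 2 ^ k * B"
      using W(2)[OF that] D(1) by (intro mult_left_mono) auto
    with * show "\<bar>U (k + l) z - U k z\<bar> \<le> 2 * D * B / 2 ^ k" by simp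
  qed
  define u where "u z = lim (\<lambda>k. U k z)" for z
  have geo: "(\<lambda>k. c / 2 ^ k) \<longlonglongrightarrow> 0" for c :: real
    using tendsto_mult_right_zero[OF LIMSEQ_power_zero[of "1/2::real"], of c]
    by (simp add: power_one_over field_simps)
  have lim: "(\<lambda>k. U k z) \<longlonglongrightarrow> u z" if "z \<in> S" for z
  proof -
    have "Cauchy (\<lambda>k. U k z)"
      unfolding Cauchy_altdef2 dist_real_def
    proof (intro allI impI)
      fix e :: real assume "0 < e"
      then have "\<forall>\<^sub>F k in sequentially. 2 * D * B / 2 ^ k < e"
        using order_tendstoD(2)[OF geo] by blast
      then obtain N where N: "\<And>k. k \<ge> N \<Longrightarrow> 2 * D * B / 2 ^ k < e"
        by (auto simp: eventually_sequentially)
      have "\<bar>U l z - U N z\<bar> < e" if "l \<ge> N" for l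
        using cauchy'[OF \<open>z \<in> S\<close>, of N "l - N"] N[of N] that by simp
      then show "\<exists>N. \<forall>l\<ge>N. \<bar>U l z - U N z\<bar> < e" by blast
    qed
    then show ?thesis unfolding u_def using Cauchy_convergent convergent_LIMSEQ_iff by blast
  qed
  \<comment> \<open>The error stays in units of \<open>W\<close>, since \<open>contr\<close> is
    applied to \<open>u\<close> and \<open>U k\<close> below and accepts only weighted
    bounds.\<close>
  have uU: "\<bar>u z - U k z\<bar> \<le> 2 * D / 2 ^ k * W z" if "z \<in> S" for k z
  proof (rule LIMSEQ_le_const2)
    show "(\<lambda>l. \<bar>U (l + k) z - U k z\<bar>) \<longlonglongrightarrow> \<bar>u z - U k z\<bar>"
      using LIMSEQ_ignore_initial_segment[OF lim[OF that], of k] by (intro tendsto_intros)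
    show "\<exists>N. \<forall>l\<ge>N. \<bar>U (l + k) z - U k z\<bar> \<le> 2 * D / 2 ^ k * W z"
      using cauchyW[OF that, of k] by (simp add: add.commute)
  qed
  have "uniform_limit S U u sequentially"
  proof (rule uniform_limitI)
    fix e :: real assume "0 < e"
    then have "\<forall>\<^sub>F k in sequentially. 2 * D * B / 2 ^ k < e"
      using order_tendstoD(2)[OF geo] by blast
    then show "\<forall>\<^sub>F k in sequentially. \<forall>z\<in>S. dist (U k z) (u z) < e"
    proof eventually_elim
      case (elim k)
      show ?case
      proof
        fix z assume z: "z \<in> S"
        have "2 * D / 2 ^ k * W z \<le> 2 * D / 2 ^ k * B"
          using W(2)[OF z] D(1) by (intro mult_left_mono) auto
        then show "dist (U k z) (u z) < e"
          using uU[OF z, of k] elim by (simp add: dist_real_def abs_minus_commute)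
      qed
    qed
  qed
  with UM have uM: "u \<in> M" using closed by blast
  have fix1: "F u z = u z" if z: "z \<in> S" for z
  proof -
    have "\<bar>F u z - u z\<bar> \<le> 2 * D * W z / 2 ^ k" for k
    proof -
      have "\<forall>z\<in>S. \<bar>F u z - F (U k) z\<bar> \<le> 2 * D / 2 ^ k / 2 * W z"
        by (rule contr[OF uM UM]) (use D uU in auto)
      then have "\<bar>F u z - U (Suc k) z\<bar> \<le> D * W z / 2 ^ k"
        using z by (simp add: US)
      moreover have "\<bar>u z - U (Suc k) z\<bar> \<le> D * W z / 2 ^ k"
        using uU[OF z, of "Suc k"] by simp
      ultimately show ?thesis by linarith
    qed
    then have "\<bar>F u z - u z\<bar> \<le> 0" by (intro LIMSEQ_le_const[OF geo]) auto
    then show ?thesis by simp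
  qed
  have uniq: "v z = u z" if v: "v \<in> M" "\<And>z. z \<in> S \<Longrightarrow> F v z = v z" and z: "z \<in> S" for v z
  proof -
    obtain E where E: "E \<ge> 0" "\<forall>z\<in>S. \<bar>v z - u z\<bar> \<le> E * W z"
      using dist[OF v(1) uM] by blast
    have *: "\<forall>z\<in>S. \<bar>v z - u z\<bar> \<le> E / 2 ^ k * W z" for k
    proof (induction k)
      case 0
      show ?case using E by simp
    next
      case (Suc k)
      have "\<forall>z\<in>S. \<bar>F v z - F u z\<bar> \<le> E / 2 ^ k / 2 * W z"
        by (rule contr[OF v(1) uM _ Suc]) (use E in simp)
      then show ?case using v(2) fix1 by (simp add: field_simps)
    qed
    have "\<bar>v z - u z\<bar> \<le> E * W z / 2 ^ k" for k using * z by simp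
    then have "\<bar>v z - u z\<bar> \<le> 0" by (intro LIMSEQ_le_const[OF geo]) auto
    then show ?thesis by simp
  qed
  show thesis using that uM fix1 uniq by blast
qed

section \<open>Bounded Borel functions and integrals along line segments\<close>

lemma bounded_borel_on_iff:
  assumes "S \<in> sets borel"
  shows "bounded_borel_on S f \<longleftrightarrow>
    (\<lambda>z. indicator S z * f z) \<in> borel_measurable borel \<and> (\<exists>B. \<forall>z\<in>S. \<bar>f z\<bar> \<le> B)"
  using assms by (simp add: bounded_borel_on_def bounded_iff borel_measurable_restrict_space_iff)

lemma tri_dom_borel [measurable]: "tri_dom \<in> sets borel"
proof -
  have "tri_dom = {z. 0 \<le> snd z} \<inter> {z. snd z \<le> fst z} \<inter> {z. fst z \<le> 1}"
    by (auto simp: tri_dom_def)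
  moreover have "closed \<dots>"
    by (intro closed_Int closed_Collect_le continuous_intros)
  ultimately show ?thesis by simp
qed

lemma bounded_borel_on_uniform_limit:
  assumes S: "S \<in> sets borel" and "\<And>k. bounded_borel_on S (f k)"
    and lim: "uniform_limit S f g sequentially"
  shows "bounded_borel_on S g"
proof -
  have "(\<lambda>z. indicator S z * g z) \<in> borel_measurable borel"
  proof (rule borel_measurable_LIMSEQ_real)
    show "(\<lambda>k. indicator S z * f k z) \<longlonglongrightarrow> indicator S z * g z" for z
      using tendsto_uniform_limitI[OF lim] by (cases "z \<in> S") (auto simp: indicator_def)
    show "(\<lambda>z. indicator S z * f k z) \<in> borel_measurable borel" for k
      using assms(2)[of k] S by (simp add: bounded_borel_on_iff)
  qed
  moreover have "\<exists>B. \<forall>z\<in>S. \<bar>g z\<bar> \<le> B"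
  proof -
    obtain k where k: "\<forall>z\<in>S. dist (f k z) (g z) < 1"
      using uniform_limitD[OF lim, of 1] by (auto simp: eventually_sequentially)
    obtain B where "\<forall>z\<in>S. \<bar>f k z\<bar> \<le> B" using assms(2)[of k] S by (auto simp: bounded_borel_on_iff)
    with k have "\<forall>z\<in>S. \<bar>g z\<bar> \<le> B + 1" by (force simp: dist_real_def)
    then show ?thesis ..
  qed
  ultimately show ?thesis using S by (simp add: bounded_borel_on_iff)
qed

lemma bounded_borel_on_const: "S \<in> sets borel \<Longrightarrow> bounded_borel_on S (\<lambda>z. c)"
  by (auto simp: bounded_borel_on_iff)

lemma bounded_borel_on_cong:
  assumes "S \<in> sets borel" and "\<And>z. z \<in> S \<Longrightarrow> f z = g z"
  shows "bounded_borel_on S f \<longleftrightarrow> bounded_borel_on S g"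
proof -
  have "(\<lambda>z. indicator S z * f z) = (\<lambda>z. indicator S z * g z)"
    using assms by (auto simp: indicator_def)
  then show ?thesis using assms by (simp add: bounded_borel_on_iff)
qed

lemma bounded_borel_on_add:
  assumes "bounded_borel_on S f" "bounded_borel_on S g"
  shows "bounded_borel_on S (\<lambda>z. f z + g z)"
  using assms unfolding bounded_borel_on_def by (auto intro!: bounded_plus_comp)

lemma bounded_borel_on_cmult:
  fixes c :: real
  assumes "bounded_borel_on S f"
  shows "bounded_borel_on S (\<lambda>z. c * f z)"
  using assms bounded_scaleR_comp[of f S c] unfolding bounded_borel_on_def by auto

lemma bounded_borel_on_sum:
  assumes "S \<in> sets borel" "\<And>i. i \<in> I \<Longrightarrow> bounded_borel_on S (f i)"
  shows "bounded_borel_on S (\<lambda>z. \<Sum>i\<in>I. f i z)"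
  using assms(2)
  by (induction I rule: infinite_finite_induct)
    (simp_all add: bounded_borel_on_const[OF assms(1)] bounded_borel_on_add)

text \<open>The hypothesis on \<open>g\<close> is restricted to the part where \<open>P\<close>
  fails because in the boundary term \<open>g\<close> evaluates \<open>K\<close> at the foot on
  \<open>\<xi> = 0\<close>, and only there is this foot guaranteed to lie in the triangle.\<close>

lemma bounded_borel_on_if:
  assumes S: "S \<in> sets borel" and P: "{z. P z} \<in> sets borel"
    and f: "bounded_borel_on S f" and g: "bounded_borel_on (S \<inter> {z. \<not> P z}) g"
  shows "bounded_borel_on S (\<lambda>z. if P z then f z else g z)"
proof -
  have N: "S \<inter> {z. \<not> P z} \<in> sets borel" using S P by (simp add: Collect_neg_eq)
  have "(\<lambda>z. indicator S z * (if P z then f z else g z)) =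
      (\<lambda>z. if P z then indicator S z * f z else indicator (S \<inter> {z. \<not> P z}) z * g z)"
    by (auto simp: indicator_def)
  also have "\<dots> \<in> borel_measurable borel"
    using f g P S N by (intro measurable_If) (simp_all add: bounded_borel_on_iff)
  finally have "(\<lambda>z. indicator S z * (if P z then f z else g z)) \<in> borel_measurable borel" .
  moreover obtain B C where "\<forall>z\<in>S. \<bar>f z\<bar> \<le> B" "\<forall>z\<in>S \<inter> {z. \<not> P z}. \<bar>g z\<bar> \<le> C"
    using f g S N by (auto simp: bounded_borel_on_iff)
  then have "\<exists>B. \<forall>z\<in>S. \<bar>if P z then f z else g z\<bar> \<le> B" by (intro exI[of _ "max B C"]) force
  ultimately show ?thesis using S by (simp only: bounded_borel_on_iff simp_thms)
qed

text \<open>This is where Borel measurability matters: it survives restriction to segments and sides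
  of the triangle, which are null sets of the plane.\<close>

lemma bounded_borel_on_compose:
  assumes "S \<in> sets borel" "T \<in> sets borel" "bounded_borel_on T f"
    and h: "h \<in> borel_measurable borel" and "\<And>z. z \<in> S \<Longrightarrow> h z \<in> T"
  shows "bounded_borel_on S (\<lambda>z. f (h z))"
proof -
  have f: "(\<lambda>z. indicator T z * f z) \<in> borel_measurable borel"
    using assms by (simp add: bounded_borel_on_iff)
  have "(\<lambda>z. indicator S z * f (h z)) = (\<lambda>z. indicator S z * (indicator T (h z) * f (h z)))"
    using assms by (auto simp: indicator_def)
  also have "\<dots> \<in> borel_measurable borel"
    by (rule borel_measurable_times[OF borel_measurable_indicator[OF assms(1)] measurable_compose[OF h f]])
  finally show ?thesis
    using assms unfolding bounded_borel_on_iff[OF assms(1)] bounded_borel_on_iff[OF assms(2)] by blast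
qed

text \<open>Any Borel parametrization \<open>h\<close> of a curve in the triangle gives a bounded
  Borel trace; the three sides are three choices of \<open>h\<close>, and the essential bound is a
  pointwise one.\<close>

lemma traces_Linf_if_bounded_borel_on:
  assumes "bounded_borel_on tri_dom f"
  shows "traces_Linf f"
proof -
  have *: "(\<lambda>x. f (h x)) \<in> Linf_on {0<..<1}"
    if "h \<in> borel_measurable borel" "\<And>x. x \<in> {0<..<1} \<Longrightarrow> h x \<in> tri_dom" for h
  proof -
    have "bounded_borel_on {0<..<1} (\<lambda>x. f (h x))"
      by (rule bounded_borel_on_compose[OF _ tri_dom_borel assms]) (use that in auto)
    then obtain B where "\<forall>x\<in>{0<..<1}. \<bar>f (h x)\<bar> \<le> B"
      and m: "(\<lambda>x. f (h x)) \<in> borel_measurable (restrict_space borel {0<..<1})"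
      unfolding bounded_borel_on_def bounded_iff by auto
    then have "AE x in restrict_space lborel {0<..<1}. \<bar>f (h x)\<bar> \<le> B"
      by (intro AE_I2) (simp add: space_restrict_space)
    moreover have "(\<lambda>x. f (h x)) \<in> borel_measurable (restrict_space lborel {0<..<1})"
      using m measurable_cong_sets[OF sets_restrict_space_cong[OF sets_lborel] refl] by blast
    ultimately show ?thesis unfolding Linf_on_def by blast
  qed
  show ?thesis unfolding traces_Linf_def
    by (intro conjI *) (auto simp: tri_dom_def borel_prod[symmetric])
qed

section \<open>Parameter integrals along segments of variable length\<close>

lemma indicator_atLeastAtMost_measurable:
  fixes e :: "'a \<Rightarrow> real"
  assumes [measurable]: "e \<in> borel_measurable M"
  shows "(\<lambda>(z, s). indicator {0..e z} s :: real) \<in> borel_measurable (M \<Otimes>\<^sub>M lborel)"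
proof -
  have "(\<lambda>(z, s). indicator {0..e z} s :: real) = (\<lambda>p. if 0 \<le> snd p \<and> snd p \<le> e (fst p) then 1 else 0)"
    by (auto simp: indicator_def)
  also have "\<dots> \<in> borel_measurable (M \<Otimes>\<^sub>M lborel)" by measurable
  finally show ?thesis .
qed

lemma char_integrable:
  assumes g: "bounded_borel_on tri_dom g"
    and seg: "\<And>s. 0 \<le> s \<Longrightarrow> s \<le> e \<Longrightarrow> (x + a * s, y + b * s) \<in> tri_dom"
  shows "set_integrable lborel {0..e} (\<lambda>s. g (x + a * s, y + b * s))"
proof -
  obtain B where B: "\<forall>z\<in>tri_dom. \<bar>g z\<bar> \<le> B" using g by (auto simp: bounded_borel_on_iff)
  have "bounded_borel_on {0..e} (\<lambda>s. g (x + a * s, y + b * s))"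
    using seg by (intro bounded_borel_on_compose[OF _ tri_dom_borel g]) (auto simp: borel_prod[symmetric])
  then have m: "(\<lambda>s. indicator {0..e} s * g (x + a * s, y + b * s)) \<in> borel_measurable borel"
    by (simp add: bounded_borel_on_iff)
  show ?thesis unfolding set_integrable_def real_scaleR_def
    by (rule integrableI_bounded_set[where A="{0..e}" and B=B])
      (use m B seg in \<open>auto simp: emeasure_lborel_Icc_eq indicator_def\<close>)
qed

text \<open>Both the integrand and the end point depend on \<open>z\<close>. The end point becomes
  an indicator that is jointly measurable in \<open>(z, s)\<close>, and \<open>g\<close> is extended
  by zero to the whole plane; what remains is a parameter integral of a jointly measurable function
  over a fixed measure space.\<close>

lemma bounded_borel_on_char_integral:
  assumes g: "bounded_borel_on tri_dom g" and e[measurable]: "e \<in> borel_measurable borel"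
    and E: "\<And>z. z \<in> tri_dom \<Longrightarrow> e z \<le> E"
    and seg: "\<And>x y s. (x, y) \<in> tri_dom \<Longrightarrow> 0 \<le> s \<Longrightarrow> s \<le> e (x, y) \<Longrightarrow> (x + a * s, y + b * s) \<in> tri_dom"
  shows "bounded_borel_on tri_dom (\<lambda>z. LBINT s:{0..e z}. g (fst z + a * s, snd z + b * s))"
proof -
  define G where "G z = indicator tri_dom z * g z" for z
  have [measurable]: "G \<in> borel_measurable borel"
    using g unfolding G_def by (simp add: bounded_borel_on_iff)
  obtain B where B: "\<forall>z\<in>tri_dom. \<bar>g z\<bar> \<le> B" using g by (auto simp: bounded_borel_on_iff)
  have B0: "0 \<le> B" using B[rule_format, of "(0,0)"] by (auto simp: tri_dom_def)
  have gG: "(LBINT s:{0..e z}. g (fst z + a * s, snd z + b * s)) =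
      (\<integral>s. indicator {0..e z} s * G (fst z + a * s, snd z + b * s) \<partial>lborel)" if "z \<in> tri_dom" for z
    unfolding set_lebesgue_integral_def
  proof (rule Bochner_Integration.integral_cong)
    fix s
    show "indicator {0..e z} s *\<^sub>R g (fst z + a * s, snd z + b * s) =
         indicator {0..e z} s * G (fst z + a * s, snd z + b * s)"
      using seg[of "fst z" "snd z" s] that by (auto simp: G_def indicator_def)
  qed simp
  have "(\<lambda>z. \<integral>s. indicator {0..e z} s * G (fst z + a * s, snd z + b * s) \<partial>lborel) \<in> borel_measurable borel"
  proof (rule lborel.borel_measurable_lebesgue_integral)
    have "(\<lambda>p. (fst (fst p) + a * snd p, snd (fst p) + b * snd p)) \<in>
        borel_measurable (borel \<Otimes>\<^sub>M lborel)"
      by (simp add: borel_prod[symmetric])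
    then have "(\<lambda>(z, s). G (fst z + a * s, snd z + b * s)) \<in> borel_measurable (borel \<Otimes>\<^sub>M lborel)"
      by (simp add: case_prod_beta')
    then show "(\<lambda>(z, s). indicator {0..e z} s * G (fst z + a * s, snd z + b * s))
        \<in> borel_measurable (borel \<Otimes>\<^sub>M lborel)"
      using borel_measurable_times[OF indicator_atLeastAtMost_measurable[OF e]]
      by (simp add: case_prod_beta')
  qed
  then have "bounded_borel_on tri_dom
    (\<lambda>z. \<integral>s. indicator {0..e z} s * G (fst z + a * s, snd z + b * s) \<partial>lborel)"
  proof (unfold bounded_borel_on_iff[OF tri_dom_borel], intro conjI exI ballI)
    fix z assume z: "z \<in> tri_dom"
    have seg': "(fst z + a * s, snd z + b * s) \<in> tri_dom" if "0 \<le> s" "s \<le> e z" for s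
      using seg[of "fst z" "snd z" s] z that by simp
    have "\<bar>LBINT s:{0..e z}. g (fst z + a * s, snd z + b * s)\<bar>
        \<le> (LBINT s:{0..e z}. \<bar>g (fst z + a * s, snd z + b * s)\<bar>)"
      using set_integral_norm_bound[OF char_integrable[OF g seg']] by simp
    also have "\<dots> \<le> (LBINT s:{0..e z}. B)"
      using B seg'
      by (intro set_integral_mono set_integrable_abs char_integrable[OF g seg']
          borel_integrable_atLeastAtMost' continuous_intros) auto
    \<comment> \<open>No sign of \<open>e z\<close> is assumed; for negative values the interval is
      empty, hence the maximum with 0.\<close>
    also have "\<dots> = max 0 (e z) * B"
      by (subst set_integral_const) (auto simp: emeasure_lborel_Icc_eq measure_def max_def)
    also have "\<dots> \<le> B * \<bar>E\<bar>"
      using E[OF z] B0 by (subst mult.commute, intro mult_left_mono) auto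
    finally show "\<bar>\<integral>s. indicator {0..e z} s * G (fst z + a * s, snd z + b * s) \<partial>lborel\<bar> \<le> B * \<bar>E\<bar>"
      by (simp add: gG[OF z])
  qed auto
  then show ?thesis
    by (subst bounded_borel_on_cong[OF tri_dom_borel gG])
qed

text \<open>Along the segment the exponent falls at rate at least \<open>\<gamma> * c\<close>, so
  the weight is at most its starting value times \<open>exp (- \<gamma> * c * s)\<close>, whose
  integral over the half-line is \<open>1 / (\<gamma> * c)\<close>. The bound is thus independent of
  the length \<open>e\<close> and small for large \<open>\<gamma>\<close>.\<close>

lemma char_integral_diff_le:
  assumes g: "bounded_borel_on tri_dom g" and h: "bounded_borel_on tri_dom h"
    and "0 \<le> e" and seg: "\<And>s. 0 \<le> s \<Longrightarrow> s \<le> e \<Longrightarrow> (x + a * s, y + b * s) \<in> tri_dom"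
    and D: "0 \<le> D" "\<And>z. z \<in> tri_dom \<Longrightarrow> \<bar>g z - h z\<bar> \<le> D * exp (\<gamma> * (fst z - \<theta> * snd z))"
    and "0 < \<gamma>" "0 < c" and decay: "a - \<theta> * b \<le> - c"
  shows "\<bar>(LBINT s:{0..e}. g (x + a * s, y + b * s)) - (LBINT s:{0..e}. h (x + a * s, y + b * s))\<bar>
    \<le> D * exp (\<gamma> * (x - \<theta> * y)) / (\<gamma> * c)"
proof -
  let ?z = "\<lambda>s. (x + a * s, y + b * s)"
  define k where "k = \<gamma> * c"
  have k: "k > 0" using assms by (simp add: k_def)
  define E where "E = D * exp (\<gamma> * (x - \<theta> * y))"
  have E: "E \<ge> 0" using D(1) by (simp add: E_def)
  have gi: "set_integrable lborel {0..e} (\<lambda>s. g (?z s))" and hi: "set_integrable lborel {0..e} (\<lambda>s. h (?z s))"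
    using char_integrable[OF g seg] char_integrable[OF h seg] by auto
  have di: "set_integrable lborel {0..e} (\<lambda>s. g (?z s) - h (?z s))"
    using gi hi by simp
  have le: "\<bar>g (?z s) - h (?z s)\<bar> \<le> E * exp (- k * s)" if "s \<in> {0..e}" for s
  proof -
    have "(a - \<theta> * b) * s \<le> - c * s"
      using decay that by (intro mult_right_mono) auto
    then have "(x + a * s) - \<theta> * (y + b * s) \<le> (x - \<theta> * y) - c * s"
      by (simp add: algebra_simps)
    then have "\<gamma> * ((x + a * s) - \<theta> * (y + b * s)) \<le> \<gamma> * ((x - \<theta> * y) - c * s)"
      using \<open>0 < \<gamma>\<close> by (intro mult_left_mono) auto
    then have "D * exp (\<gamma> * ((x + a * s) - \<theta> * (y + b * s))) \<le> D * exp (\<gamma> * ((x - \<theta> * y) - c * s))"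
      using D(1) by (intro mult_left_mono) auto
    also have "\<dots> = E * exp (- k * s)"
      by (simp add: E_def k_def exp_add[symmetric] algebra_simps)
    finally show ?thesis using D(2)[of "?z s"] seg that by fastforce
  qed
  have "\<bar>(LBINT s:{0..e}. g (?z s)) - (LBINT s:{0..e}. h (?z s))\<bar>
      = \<bar>LBINT s:{0..e}. g (?z s) - h (?z s)\<bar>"
    using gi hi by simp
  also have "\<dots> \<le> (LBINT s:{0..e}. \<bar>g (?z s) - h (?z s)\<bar>)"
    using set_integral_norm_bound[OF di] by simp
  also have "\<dots> \<le> (LBINT s:{0..e}. E * exp (- k * s))"
  proof (rule set_integral_mono)
    show "set_integrable lborel {0..e} (\<lambda>s. E * exp (- k * s))"
      by (intro borel_integrable_atLeastAtMost' continuous_intros)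
  qed (use di le in \<open>auto intro: set_integrable_abs\<close>)
  also have "\<dots> = (- E / k * exp (- k * e)) - (- E / k * exp (- k * 0))"
    unfolding set_lebesgue_integral_def
  proof (rule integral_FTC_atLeastAtMost)
    show "((\<lambda>s. - E / k * exp (- k * s)) has_vector_derivative E * exp (- k * s)) (at s within {0..e})" for s
      using k by (auto intro!: derivative_eq_intros simp flip: has_real_derivative_iff_has_vector_derivative)
  qed (use \<open>0 \<le> e\<close> in \<open>auto intro!: continuous_intros\<close>)
  also have "\<dots> \<le> E / k" using E k by simp
  finally show ?thesis by (simp add: E_def k_def)
qed

lemma abs_weighted_sum_diff_le:
  fixes f g w :: "'a \<Rightarrow> real"
  assumes "\<And>k. k \<in> A \<Longrightarrow> \<bar>f k - g k\<bar> \<le> E"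
  shows "\<bar>(\<Sum>k\<in>A. w k * f k) - (\<Sum>k\<in>A. w k * g k)\<bar> \<le> (\<Sum>k\<in>A. \<bar>w k\<bar>) * E"
proof -
  have "\<bar>(\<Sum>k\<in>A. w k * f k) - (\<Sum>k\<in>A. w k * g k)\<bar> = \<bar>\<Sum>k\<in>A. w k * (f k - g k)\<bar>"
    by (simp add: sum_subtractf algebra_simps)
  also have "\<dots> \<le> (\<Sum>k\<in>A. \<bar>w k * (f k - g k)\<bar>)" by (rule sum_abs)
  also have "\<dots> \<le> (\<Sum>k\<in>A. \<bar>w k\<bar> * E)"
    using assms by (intro sum_mono) (simp add: abs_mult mult_left_mono)
  finally show ?thesis by (simp add: sum_distrib_right)
qed

lemma K_source_diff_le:
  assumes "\<And>k. k \<in> {1..n} \<Longrightarrow> \<bar>K i k z - K' i k z\<bar> \<le> E"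
    and "\<And>p. p \<in> {1..m} \<Longrightarrow> \<bar>L i p z - L' i p z\<bar> \<le> E"
  shows "\<bar>K_source m n \<sigma>pp \<sigma>mp K L i j z - K_source m n \<sigma>pp \<sigma>mp K' L' i j z\<bar>
    \<le> ((\<Sum>k=1..n. \<bar>\<sigma>pp k j\<bar>) + (\<Sum>p=1..m. \<bar>\<sigma>mp p j\<bar>)) * E"
proof -
  have "\<bar>(\<Sum>k=1..n. \<sigma>pp k j * K i k z) - (\<Sum>k=1..n. \<sigma>pp k j * K' i k z)\<bar> \<le> (\<Sum>k=1..n. \<bar>\<sigma>pp k j\<bar>) * E"
    by (rule abs_weighted_sum_diff_le) (use assms in blast)
  moreover have "\<bar>(\<Sum>p=1..m. \<sigma>mp p j * L i p z) - (\<Sum>p=1..m. \<sigma>mp p j * L' i p z)\<bar> \<le> (\<Sum>p=1..m. \<bar>\<sigma>mp p j\<bar>) * E"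
    by (rule abs_weighted_sum_diff_le) (use assms in blast)
  ultimately show ?thesis unfolding K_source_def by (simp add: algebra_simps)
qed

text \<open>The two sources differ by exchanging the roles of \<open>(K, n)\<close> and
  \<open>(L, m)\<close>, so one difference estimate serves both.\<close>

lemma L_source_eq_K_source: "L_source m n \<sigma>mm \<sigma>pm K L = K_source n m \<sigma>mm \<sigma>pm L K"
  by (intro ext) (simp add: L_source_def K_source_def)

section \<open>The kernel system\<close>

locale kernel_system =
  fixes m n :: nat and \<mu> lam :: "nat \<Rightarrow> real"
    and \<sigma>pp \<sigma>pm \<sigma>mp \<sigma>mm q :: "nat \<Rightarrow> nat \<Rightarrow> real"
  assumes mu_pos: "i \<in> {1..m} \<Longrightarrow> 0 < \<mu> i"
    and mu_less: "i \<in> {1..m} \<Longrightarrow> j \<in> {1..m} \<Longrightarrow> i < j \<Longrightarrow> \<mu> j < \<mu> i"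
    and lam_pos: "j \<in> {1..n} \<Longrightarrow> 0 < lam j"
begin

text \<open>Finitely many strict inequalities must hold for one \<open>\<theta>\<close>; the slack
  they leave then has a common lower bound \<open>c\<close>. For \<open>i = j\<close> the rate of
  decrease is \<open>\<mu> i * (1 - \<theta>)\<close>, which forces \<open>\<theta> < 1\<close>; for
  \<open>i > j\<close> it is positive only if \<open>\<theta> > \<mu> i / \<mu> j\<close>, a number
  below 1. Hence the filter \<open>at_left 1\<close>.\<close>

lemma obtain_decay_rate:
  obtains \<theta> c where "0 < \<theta>" "\<theta> < 1" "0 < c"
    "\<And>i j. i \<in> {1..m} \<Longrightarrow> j \<in> {1..n} \<Longrightarrow> - \<mu> i - \<theta> * lam j \<le> - c"
    "\<And>i j. i \<in> {1..m} \<Longrightarrow> j \<in> {1..m} \<Longrightarrow> orient i j * \<mu> i - \<theta> * (orient i j * \<mu> j) \<le> - c"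
proof -
  have 01: "\<forall>\<^sub>F \<theta> in at_left 1. \<theta> \<in> {0<..<1::real}"
    by (rule eventually_at_left_real) simp
  have "\<forall>\<^sub>F \<theta> in at_left 1. orient i j * \<mu> i - \<theta> * (orient i j * \<mu> j) < 0"
    if "i \<in> {1..m}" "j \<in> {1..m}" for i j
  \<comment> \<open>On the diagonal the expression tends to 0, so its sign has to be read off for
    each \<open>\<theta> < 1\<close>; off the diagonal the limit is minus the distance of the two
    speeds, and continuity suffices.\<close>
  proof (cases "i = j")
    case True
    from 01 show ?thesis
      by eventually_elim (use True mu_pos[OF that(1)] in \<open>simp add: orient_def\<close>)
  next
    case False
    have "((\<lambda>\<theta>. orient i j * \<mu> i - \<theta> * (orient i j * \<mu> j)) \<longlongrightarrow>
        orient i j * \<mu> i - 1 * (orient i j * \<mu> j)) (at_left 1)"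
      by (intro tendsto_intros)
    then show ?thesis
      by (rule order_tendstoD(2))
        (use False mu_less[of i j] mu_less[of j i] that in \<open>auto simp: orient_def\<close>)
  qed
  then have "\<forall>\<^sub>F \<theta> in at_left 1. \<forall>i\<in>{1..m}. \<forall>j\<in>{1..m}. orient i j * \<mu> i - \<theta> * (orient i j * \<mu> j) < 0"
    by (intro eventually_ball_finite ballI) auto
  with 01 have "\<forall>\<^sub>F \<theta> in at_left 1. \<theta> \<in> {0<..<1} \<and>
      (\<forall>i\<in>{1..m}. \<forall>j\<in>{1..m}. orient i j * \<mu> i - \<theta> * (orient i j * \<mu> j) < 0)"
    by eventually_elim auto
  from eventually_happens[OF this] obtain \<theta> where \<theta>: "0 < \<theta>" "\<theta> < 1"
    "\<And>i j. i \<in> {1..m} \<Longrightarrow> j \<in> {1..m} \<Longrightarrow> orient i j * \<mu> i - \<theta> * (orient i j * \<mu> j) < 0"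
    by (auto simp: trivial_limit_at_left_real)
  have ev: "\<forall>\<^sub>F c in at_right 0. r \<le> - c" if "r < 0" for r :: real
    using eventually_at_right_real[of 0 "- r"] that by (auto elim!: eventually_mono)
  have "\<forall>\<^sub>F c in at_right 0. (\<forall>i\<in>{1..m}. \<forall>j\<in>{1..n}. - \<mu> i - \<theta> * lam j \<le> - c) \<and>
      (\<forall>i\<in>{1..m}. \<forall>j\<in>{1..m}. orient i j * \<mu> i - \<theta> * (orient i j * \<mu> j) \<le> - c) \<and> 0 < c"
  proof (intro eventually_conj eventually_ball_finite ballI ev)
    fix i j assume "i \<in> {1..m}" "j \<in> {1..n}"
    then show "- \<mu> i - \<theta> * lam j < 0"
      using mu_pos lam_pos \<theta>(1) by (smt (verit) mult_pos_pos)
  qed (use \<theta>(3) in \<open>simp_all add: eventually_at_right_less\<close>)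
  from eventually_happens[OF this] obtain c where "0 < c"
    "\<And>i j. i \<in> {1..m} \<Longrightarrow> j \<in> {1..n} \<Longrightarrow> - \<mu> i - \<theta> * lam j \<le> - c"
    "\<And>i j. i \<in> {1..m} \<Longrightarrow> j \<in> {1..m} \<Longrightarrow> orient i j * \<mu> i - \<theta> * (orient i j * \<mu> j) \<le> - c"
    by (auto simp: trivial_limit_at_right_real)
  with \<theta>(1,2) that show thesis by blast
qed

section \<open>Geometry of the characteristics inside the triangle\<close>

lemma s_end_bounds:
  assumes "i \<in> {1..m}" "j \<in> {1..n}" "(x, y) \<in> tri_dom"
  shows "0 \<le> s_end \<mu> lam i j x y" "s_end \<mu> lam i j x y \<le> 1 / (\<mu> i + lam j)"
  using mu_pos[OF assms(1)] lam_pos[OF assms(2)] assms(3)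
  by (auto simp: s_end_def tri_dom_def intro!: divide_right_mono)

text \<open>The gap between the coordinates shrinks at rate \<open>\<mu> i + lam j\<close> and
  closes exactly at \<open>s_end\<close>; the other two sides are not crossed, as the first
  coordinate falls and the second rises. Writing \<open>+ - \<mu> i * s\<close> matches the pattern
  \<open>x + a * s\<close> of the general segment lemmas.\<close>

lemma K_characteristic_in_tri_dom:
  assumes "i \<in> {1..m}" "j \<in> {1..n}" "(x, y) \<in> tri_dom" "0 \<le> s" "s \<le> s_end \<mu> lam i j x y"
  shows "(x + - \<mu> i * s, y + lam j * s) \<in> tri_dom"
proof -
  have p: "0 < \<mu> i" "0 < lam j" using mu_pos lam_pos assms by auto
  then have "s * (\<mu> i + lam j) \<le> x - y"
    using assms(5) by (simp add: s_end_def pos_le_divide_eq)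
  moreover have "0 \<le> \<mu> i * s" "0 \<le> lam j * s" using p assms(4) by auto
  ultimately show ?thesis using assms(3) by (simp add: tri_dom_def algebra_simps)
qed

text \<open>One upper bound covers all three branches: each end time is at most the time one
  coordinate needs to cross the unit interval.\<close>

lemma nu_end_bounds:
  assumes "i \<in> {1..m}" "j \<in> {1..m}" "(x, y) \<in> tri_dom"
  shows "0 \<le> nu_end \<mu> i j x y" "nu_end \<mu> i j x y \<le> 1 / \<mu> i + 1 / \<mu> j"
proof -
  have p: "0 < \<mu> i" "0 < \<mu> j" using mu_pos assms by auto
  have xy: "0 \<le> y" "y \<le> x" "x \<le> 1" using assms(3) by (auto simp: tri_dom_def)
  show "0 \<le> nu_end \<mu> i j x y"
    using p xy mu_less[of i j] mu_less[of j i] assms(1,2) by (auto simp: nu_end_def)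
  have "(1 - x) / \<mu> i \<le> 1 / \<mu> i" "y / \<mu> i \<le> 1 / \<mu> i" "y / \<mu> j \<le> 1 / \<mu> j" "0 \<le> 1 / \<mu> i" "0 \<le> 1 / \<mu> j"
    using p xy by (auto intro!: divide_right_mono)
  then show "nu_end \<mu> i j x y \<le> 1 / \<mu> i + 1 / \<mu> j"
    unfolding nu_end_def by (smt (verit))
qed

text \<open>With this orientation the gap \<open>x - y\<close> never widens: it changes at minus the
  distance of the speeds \<open>\<mu> i\<close> and \<open>\<mu> j\<close>. For distinct indices the
  two entries of the minimum in \<open>nu_end\<close> are the times at which the gap closes and at
  which \<open>x = 1\<close> or \<open>y = 0\<close> is hit; for \<open>i = j\<close> the gap is
  constant and only \<open>y = 0\<close> can be reached.\<close>

lemma L_characteristic_in_tri_dom: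
  assumes ij: "i \<in> {1..m}" "j \<in> {1..m}" and xy: "(x, y) \<in> tri_dom" and s: "0 \<le> s" "s \<le> nu_end \<mu> i j x y"
  shows "(x + orient i j * \<mu> i * s, y + orient i j * \<mu> j * s) \<in> tri_dom"
proof -
  have p: "0 < \<mu> i" "0 < \<mu> j" using mu_pos ij by auto
  then have nn: "0 \<le> \<mu> i * s" "0 \<le> \<mu> j * s" using s by auto
  consider "i > j" | "i = j" | "i < j" by linarith
  then show ?thesis
  proof cases
    case 1
    then have "\<mu> i < \<mu> j" using mu_less ij by blast
    moreover have "s * \<mu> i \<le> 1 - x" "s * (\<mu> j - \<mu> i) \<le> x - y"
      using s(2) 1 p \<open>\<mu> i < \<mu> j\<close> by (simp_all add: nu_end_def pos_le_divide_eq)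
    ultimately show ?thesis using 1 xy nn by (simp add: orient_def tri_dom_def algebra_simps)
  next
    case 2
    then have "s * \<mu> i \<le> y" using s(2) p by (simp add: nu_end_def pos_le_divide_eq)
    then show ?thesis using 2 xy nn by (simp add: orient_def tri_dom_def algebra_simps)
  next
    case 3
    then have "\<mu> j < \<mu> i" using mu_less ij by blast
    moreover have "s * \<mu> j \<le> y" "s * (\<mu> i - \<mu> j) \<le> x - y"
      using s(2) 3 p \<open>\<mu> j < \<mu> i\<close> by (simp_all add: nu_end_def pos_le_divide_eq)
    ultimately show ?thesis using 3 xy nn by (simp add: orient_def tri_dom_def algebra_simps)
  qed
qed

text \<open>For \<open>i < j\<close>, the condition \<open>\<mu> i * y \<le> \<mu> j * x\<close> is
  equivalent to \<open>y / \<mu> j \<le> (x - y) / (\<mu> i - \<mu> j)\<close>: the side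
  \<open>y = 0\<close> is reached no later than the diagonal, so the end point does lie on it. As
  \<open>\<mu> i \<ge> \<mu> j\<close>, descending by \<open>y\<close> moves the first coordinate by
  at least \<open>y\<close>, which gives the upper bound used to compare weights.\<close>

lemma L_foot_bounds:
  assumes ij: "i \<in> {1..m}" "j \<in> {1..m}" and xy: "(x, y) \<in> tri_dom"
    and "\<not> (i > j \<or> (i < j \<and> \<mu> i * y - \<mu> j * x > 0))"
  shows "0 \<le> x - \<mu> i * nu_end \<mu> i j x y" "x - \<mu> i * nu_end \<mu> i j x y \<le> x - y"
proof -
  have p: "0 < \<mu> i" "0 < \<mu> j" using mu_pos ij by auto
  have "0 \<le> x - \<mu> i * nu_end \<mu> i j x y \<and> x - \<mu> i * nu_end \<mu> i j x y \<le> x - y"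
  proof (cases "i = j")
    case True
    then show ?thesis using p xy by (simp add: nu_end_def tri_dom_def)
  next
    case False
    then have "i < j" and le: "\<mu> i * y \<le> \<mu> j * x" using assms(4) by auto
    then have less: "\<mu> j < \<mu> i" using mu_less ij by blast
    have "y / \<mu> j \<le> (x - y) / (\<mu> i - \<mu> j)"
      using le less p by (simp add: field_simps)
    then have nu: "nu_end \<mu> i j x y = y / \<mu> j"
      using \<open>i < j\<close> by (simp add: nu_end_def)
    have "\<mu> i * (y / \<mu> j) \<le> x" using le p by (simp add: field_simps)
    moreover have "y \<le> \<mu> i * (y / \<mu> j)"
      using less p xy by (simp add: field_simps tri_dom_def mult_left_mono)
    ultimately show ?thesis by (simp add: nu)
  qed
  then show "0 \<le> x - \<mu> i * nu_end \<mu> i j x y" "x - \<mu> i * nu_end \<mu> i j x y \<le> x - y" by auto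
qed

section \<open>The right-hand side as an operator on bounded Borel families\<close>

definition K_map where
  "K_map K L i j z = k_data \<mu> lam \<sigma>mp i j +
     (LBINT s:{0..s_end \<mu> lam i j (fst z) (snd z)}.
        K_source m n \<sigma>pp \<sigma>mp K L i j (fst z + - \<mu> i * s, snd z + lam j * s))"

definition L_map where
  "L_map K L i j z = L_boundary n \<mu> lam \<sigma>mm q K i j (fst z) (snd z) -
     orient i j * (LBINT s:{0..nu_end \<mu> i j (fst z) (snd z)}.
        L_source m n \<sigma>mm \<sigma>pm K L i j
          (fst z + orient i j * \<mu> i * s, snd z + orient i j * \<mu> j * s))"

definition admissible where
  "admissible K L \<longleftrightarrow>
     (\<forall>i\<in>{1..m}. \<forall>j\<in>{1..n}. bounded_borel_on tri_dom (K i j)) \<and>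
     (\<forall>i\<in>{1..m}. \<forall>j\<in>{1..m}. bounded_borel_on tri_dom (L i j))"

lemma char_solution_iff:
  "char_solution m n \<mu> lam \<sigma>pp \<sigma>pm \<sigma>mp \<sigma>mm q K L \<longleftrightarrow> admissible K L \<and>
     (\<forall>i\<in>{1..m}. \<forall>j\<in>{1..n}. \<forall>z\<in>tri_dom. K i j z = K_map K L i j z) \<and>
     (\<forall>i\<in>{1..m}. \<forall>j\<in>{1..m}. \<forall>z\<in>tri_dom. L i j z = L_map K L i j z)"
proof -
  have split: "(\<forall>(x, y)\<in>tri_dom. P x y) \<longleftrightarrow> (\<forall>z\<in>tri_dom. P (fst z) (snd z))" for P
    by auto
  show ?thesis
    unfolding char_solution_def admissible_def K_map_def L_map_def split
    by (simp add: conj_assoc)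
qed

lemma bounded_borel_on_K_source:
  assumes "admissible K L" "i \<in> {1..m}"
  shows "bounded_borel_on tri_dom (K_source m n \<sigma>pp \<sigma>mp K L i j)"
  unfolding K_source_def[abs_def]
  using assms by (intro bounded_borel_on_add bounded_borel_on_sum bounded_borel_on_cmult tri_dom_borel)
    (auto simp: admissible_def)

lemma bounded_borel_on_L_source:
  assumes "admissible K L" "i \<in> {1..m}"
  shows "bounded_borel_on tri_dom (L_source m n \<sigma>mm \<sigma>pm K L i j)"
  unfolding L_source_def[abs_def]
  using assms by (intro bounded_borel_on_add bounded_borel_on_sum bounded_borel_on_cmult tri_dom_borel)
    (auto simp: admissible_def)

lemma bounded_borel_on_K_map:
  assumes "admissible K L" and ij: "i \<in> {1..m}" "j \<in> {1..n}"
  shows "bounded_borel_on tri_dom (K_map K L i j)"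
  unfolding K_map_def[abs_def]
proof (intro bounded_borel_on_add bounded_borel_on_const tri_dom_borel bounded_borel_on_char_integral)
  show "bounded_borel_on tri_dom (K_source m n \<sigma>pp \<sigma>mp K L i j)"
    using assms by (intro bounded_borel_on_K_source)
  show "(\<lambda>z. s_end \<mu> lam i j (fst z) (snd z)) \<in> borel_measurable borel"
    unfolding s_end_def borel_prod[symmetric] by measurable
  show "s_end \<mu> lam i j (fst z) (snd z) \<le> 1 / (\<mu> i + lam j)" if "z \<in> tri_dom" for z
    using s_end_bounds[OF ij, of "fst z" "snd z"] that by simp
qed (use K_characteristic_in_tri_dom ij in auto)

lemma nu_end_measurable: "(\<lambda>z. nu_end \<mu> i j (fst z) (snd z)) \<in> borel_measurable borel"
  unfolding nu_end_def borel_prod[symmetric] by measurable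

lemma bounded_borel_on_L_boundary:
  assumes "admissible K L" and ij: "i \<in> {1..m}" "j \<in> {1..m}"
  shows "bounded_borel_on tri_dom (\<lambda>z. L_boundary n \<mu> lam \<sigma>mm q K i j (fst z) (snd z))"
  unfolding L_boundary_def
proof (rule bounded_borel_on_if[OF tri_dom_borel _ bounded_borel_on_const[OF tri_dom_borel]])
  let ?P = "\<lambda>z. i > j \<or> (i < j \<and> \<mu> i * snd z - \<mu> j * fst z > 0)"
  have [measurable]: "Measurable.pred borel ?P"
    unfolding borel_prod[symmetric] by measurable
  then show P: "{z. ?P z} \<in> sets borel" by (simp only: pred_def space_borel UNIV_I simp_thms)
  show "bounded_borel_on (tri_dom \<inter> {z. \<not> ?P z})
     (\<lambda>z. 1 / \<mu> j * (\<Sum>r = 1..n. lam r * q r j * K i r (fst z - \<mu> i * nu_end \<mu> i j (fst z) (snd z), 0)))"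
  proof (intro bounded_borel_on_cmult bounded_borel_on_sum)
    show N: "tri_dom \<inter> {z. \<not> ?P z} \<in> sets borel"
      using sets.Diff[OF tri_dom_borel P] by (simp only: set_diff_eq Int_def mem_Collect_eq)
    fix r assume "r \<in> {1..n}"
    then have K: "bounded_borel_on tri_dom (K i r)" using assms by (auto simp: admissible_def)
    show "bounded_borel_on (tri_dom \<inter> {z. \<not> ?P z})
        (\<lambda>z. K i r (fst z - \<mu> i * nu_end \<mu> i j (fst z) (snd z), 0))"
    proof (rule bounded_borel_on_compose[OF N tri_dom_borel K])
      have "(\<lambda>z. fst z - \<mu> i * nu_end \<mu> i j (fst z) (snd z)) \<in> borel_measurable borel"
        using nu_end_measurable[of i j] unfolding borel_prod[symmetric] by measurable
      then show "(\<lambda>z. (fst z - \<mu> i * nu_end \<mu> i j (fst z) (snd z), 0 :: real)) \<in> borel_measurable borel"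
        by (simp add: borel_measurable_Pair)
      fix z assume z: "z \<in> tri_dom \<inter> {z. \<not> ?P z}"
      then show "(fst z - \<mu> i * nu_end \<mu> i j (fst z) (snd z), 0) \<in> tri_dom"
        using L_foot_bounds[OF ij, of "fst z" "snd z"] by (auto simp: tri_dom_def)
    qed
  qed
qed

lemma bounded_borel_on_L_map:
  assumes "admissible K L" and ij: "i \<in> {1..m}" "j \<in> {1..m}"
  shows "bounded_borel_on tri_dom (L_map K L i j)"
proof -
  have "bounded_borel_on tri_dom (\<lambda>z. LBINT s:{0..nu_end \<mu> i j (fst z) (snd z)}.
      L_source m n \<sigma>mm \<sigma>pm K L i j (fst z + orient i j * \<mu> i * s, snd z + orient i j * \<mu> j * s))"
  proof (rule bounded_borel_on_char_integral)
    show "bounded_borel_on tri_dom (L_source m n \<sigma>mm \<sigma>pm K L i j)"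
      using assms by (intro bounded_borel_on_L_source)
    show "nu_end \<mu> i j (fst z) (snd z) \<le> 1 / \<mu> i + 1 / \<mu> j" if "z \<in> tri_dom" for z
      using nu_end_bounds[OF ij, of "fst z" "snd z"] that by simp
  qed (use L_characteristic_in_tri_dom ij nu_end_measurable in auto)
  from bounded_borel_on_add[OF bounded_borel_on_L_boundary[OF assms] bounded_borel_on_cmult[OF this, of "- orient i j"]]
  show ?thesis by (simp add: L_map_def[abs_def])
qed

section \<open>Weighted Lipschitz estimates for the operator\<close>

lemma K_map_diff_le:
  assumes adm: "admissible K L" "admissible K' L'" and ij: "i \<in> {1..m}" "j \<in> {1..n}" and z: "z \<in> tri_dom"
    and "0 \<le> D" "0 < \<gamma>" "0 < c" "- \<mu> i - \<theta> * lam j \<le> - c"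
    and C: "(\<Sum>k=1..n. \<bar>\<sigma>pp k j\<bar>) + (\<Sum>p=1..m. \<bar>\<sigma>mp p j\<bar>) \<le> C"
    and K: "\<And>k z. k \<in> {1..n} \<Longrightarrow> z \<in> tri_dom \<Longrightarrow> \<bar>K i k z - K' i k z\<bar> \<le> D * exp (\<gamma> * (fst z - \<theta> * snd z))"
    and L: "\<And>p z. p \<in> {1..m} \<Longrightarrow> z \<in> tri_dom \<Longrightarrow> \<bar>L i p z - L' i p z\<bar> \<le> D * exp (\<gamma> * (fst z - \<theta> * snd z))"
  shows "\<bar>K_map K L i j z - K_map K' L' i j z\<bar> \<le> C * D * exp (\<gamma> * (fst z - \<theta> * snd z)) / (\<gamma> * c)"
proof -
  have "0 \<le> (\<Sum>k=1..n. \<bar>\<sigma>pp k j\<bar>) + (\<Sum>p=1..m. \<bar>\<sigma>mp p j\<bar>)" by (intro add_nonneg_nonneg sum_nonneg) auto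
  with C have "0 \<le> C" by linarith
  have src: "\<bar>K_source m n \<sigma>pp \<sigma>mp K L i j z - K_source m n \<sigma>pp \<sigma>mp K' L' i j z\<bar>
      \<le> C * D * exp (\<gamma> * (fst z - \<theta> * snd z))" if "z \<in> tri_dom" for z
  proof -
    have "\<bar>K_source m n \<sigma>pp \<sigma>mp K L i j z - K_source m n \<sigma>pp \<sigma>mp K' L' i j z\<bar>
        \<le> ((\<Sum>k=1..n. \<bar>\<sigma>pp k j\<bar>) + (\<Sum>p=1..m. \<bar>\<sigma>mp p j\<bar>)) * (D * exp (\<gamma> * (fst z - \<theta> * snd z)))"
      using K L that by (intro K_source_diff_le) auto
    also have "\<dots> \<le> C * (D * exp (\<gamma> * (fst z - \<theta> * snd z)))"
      using C \<open>0 \<le> D\<close> by (intro mult_right_mono) auto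
    finally show ?thesis by (simp add: mult.assoc)
  qed
  have "\<bar>(LBINT s:{0..s_end \<mu> lam i j (fst z) (snd z)}.
        K_source m n \<sigma>pp \<sigma>mp K L i j (fst z + - \<mu> i * s, snd z + lam j * s)) -
      (LBINT s:{0..s_end \<mu> lam i j (fst z) (snd z)}.
        K_source m n \<sigma>pp \<sigma>mp K' L' i j (fst z + - \<mu> i * s, snd z + lam j * s))\<bar>
     \<le> C * D * exp (\<gamma> * (fst z - \<theta> * snd z)) / (\<gamma> * c)"
    using assms \<open>0 \<le> C\<close> s_end_bounds[OF ij, of "fst z" "snd z"] K_characteristic_in_tri_dom[OF ij]
    by (intro char_integral_diff_le bounded_borel_on_K_source src) auto
  then show ?thesis by (simp add: K_map_def)
qed

text \<open>Nothing is integrated, so no factor \<open>1 / \<gamma>\<close> appears; it suffices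
  that the weight does not grow towards the foot, which holds because the foot is at most
  \<open>fst z - snd z\<close>, hence at most \<open>fst z - \<theta> * snd z\<close>. The constant
  data cancel.\<close>

lemma L_boundary_diff_le:
  assumes ij: "i \<in> {1..m}" "j \<in> {1..m}" and z: "z \<in> tri_dom"
    and D: "0 \<le> D" and "0 < \<gamma>" "\<theta> \<le> 1"
    and C: "1 / \<mu> j * (\<Sum>r=1..n. \<bar>lam r * q r j\<bar>) \<le> C"
    and K: "\<And>k z. k \<in> {1..n} \<Longrightarrow> z \<in> tri_dom \<Longrightarrow> \<bar>K i k z - K' i k z\<bar> \<le> D * exp (\<gamma> * (fst z - \<theta> * snd z))"
  shows "\<bar>L_boundary n \<mu> lam \<sigma>mm q K i j (fst z) (snd z) - L_boundary n \<mu> lam \<sigma>mm q K' i j (fst z) (snd z)\<bar>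
     \<le> C * D * exp (\<gamma> * (fst z - \<theta> * snd z))"
proof -
  have p: "0 < \<mu> j" using mu_pos ij by auto
  then have "0 \<le> 1 / \<mu> j * (\<Sum>r=1..n. \<bar>lam r * q r j\<bar>)" by (intro mult_nonneg_nonneg sum_nonneg) auto
  with C have "0 \<le> C" by linarith
  show ?thesis
  proof (cases "i > j \<or> (i < j \<and> \<mu> i * snd z - \<mu> j * fst z > 0)")
    case True
    then show ?thesis using D \<open>0 \<le> C\<close> by (auto simp: L_boundary_def)
  next
    case False
    let ?f = "fst z - \<mu> i * nu_end \<mu> i j (fst z) (snd z)"
    let ?E = "D * exp (\<gamma> * (fst z - \<theta> * snd z))"
    have f: "0 \<le> ?f" "?f \<le> fst z - snd z"
      using L_foot_bounds[OF ij, of "fst z" "snd z"] False z by auto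
    have zz: "0 \<le> snd z" "fst z \<le> 1" using z by (auto simp: tri_dom_def)
    then have "\<theta> * snd z \<le> snd z" using \<open>\<theta> \<le> 1\<close> mult_right_mono[of \<theta> 1 "snd z"] by simp
    with f zz have fT: "(?f, 0) \<in> tri_dom" and le: "?f \<le> fst z - \<theta> * snd z" by (auto simp: tri_dom_def)
    have "\<bar>K i r (?f, 0) - K' i r (?f, 0)\<bar> \<le> ?E" if "r \<in> {1..n}" for r
    proof -
      have "\<bar>K i r (?f, 0) - K' i r (?f, 0)\<bar> \<le> D * exp (\<gamma> * ?f)"
        using K[OF that fT] by simp
      also have "\<dots> \<le> ?E" using le D \<open>0 < \<gamma>\<close> by (intro mult_left_mono) auto
      finally show ?thesis .
    qed
    then have "\<bar>(\<Sum>r=1..n. lam r * q r j * K i r (?f, 0)) - (\<Sum>r=1..n. lam r * q r j * K' i r (?f, 0))\<bar>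
        \<le> (\<Sum>r=1..n. \<bar>lam r * q r j\<bar>) * ?E"
      by (rule abs_weighted_sum_diff_le)
    then have "1 / \<mu> j * \<bar>(\<Sum>r=1..n. lam r * q r j * K i r (?f, 0)) - (\<Sum>r=1..n. lam r * q r j * K' i r (?f, 0))\<bar>
        \<le> 1 / \<mu> j * ((\<Sum>r=1..n. \<bar>lam r * q r j\<bar>) * ?E)"
      using p by (intro mult_left_mono) auto
    also have "\<dots> \<le> C * ?E" using mult_right_mono[OF C, of ?E] D by (simp add: mult.assoc)
    finally have "1 / \<mu> j * \<bar>(\<Sum>r=1..n. lam r * q r j * K i r (?f, 0)) - (\<Sum>r=1..n. lam r * q r j * K' i r (?f, 0))\<bar>
        \<le> C * ?E" .
    moreover have "L_boundary n \<mu> lam \<sigma>mm q K i j (fst z) (snd z) - L_boundary n \<mu> lam \<sigma>mm q K' i j (fst z) (snd z)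
        = 1 / \<mu> j * ((\<Sum>r=1..n. lam r * q r j * K i r (?f, 0)) - (\<Sum>r=1..n. lam r * q r j * K' i r (?f, 0)))"
      unfolding L_boundary_def if_not_P[OF False] by (simp only: right_diff_distrib)
    ultimately show ?thesis using p by (simp add: abs_mult mult.assoc)
  qed
qed

text \<open>The scale \<open>D'\<close> for \<open>K\<close> is kept apart from the coarser
  \<open>D\<close> for \<open>L\<close>, because the boundary term sees only \<open>K\<close>. The
  source mixes both and is estimated with \<open>D\<close>, where the factor
  \<open>1 / (\<gamma> * c)\<close> compensates.\<close>

lemma L_map_diff_le:
  assumes adm: "admissible K L" "admissible K' L'" and ij: "i \<in> {1..m}" "j \<in> {1..m}" and z: "z \<in> tri_dom"
    and "0 \<le> D" "0 \<le> D'" "0 < \<gamma>" "0 < c" "\<theta> \<le> 1" "orient i j * \<mu> i - \<theta> * (orient i j * \<mu> j) \<le> - c"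
    and C: "(\<Sum>p=1..m. \<bar>\<sigma>mm p j\<bar>) + (\<Sum>k=1..n. \<bar>\<sigma>pm k j\<bar>) \<le> C" "1 / \<mu> j * (\<Sum>r=1..n. \<bar>lam r * q r j\<bar>) \<le> C"
    and K: "\<And>k z. k \<in> {1..n} \<Longrightarrow> z \<in> tri_dom \<Longrightarrow> \<bar>K i k z - K' i k z\<bar> \<le> D' * exp (\<gamma> * (fst z - \<theta> * snd z))"
    and L: "\<And>p z. p \<in> {1..m} \<Longrightarrow> z \<in> tri_dom \<Longrightarrow> \<bar>L i p z - L' i p z\<bar> \<le> D * exp (\<gamma> * (fst z - \<theta> * snd z))"
    and "D' \<le> D"
  shows "\<bar>L_map K L i j z - L_map K' L' i j z\<bar>
    \<le> C * D' * exp (\<gamma> * (fst z - \<theta> * snd z)) + C * D * exp (\<gamma> * (fst z - \<theta> * snd z)) / (\<gamma> * c)"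
proof -
  let ?L = "L_source m n \<sigma>mm \<sigma>pm"
  have "0 \<le> (\<Sum>p=1..m. \<bar>\<sigma>mm p j\<bar>) + (\<Sum>k=1..n. \<bar>\<sigma>pm k j\<bar>)" by (intro add_nonneg_nonneg sum_nonneg) auto
  with C have "0 \<le> C" by linarith
  have K'': "\<bar>K i k z - K' i k z\<bar> \<le> D * exp (\<gamma> * (fst z - \<theta> * snd z))" if "k \<in> {1..n}" "z \<in> tri_dom" for k z
  proof -
    have "D' * exp (\<gamma> * (fst z - \<theta> * snd z)) \<le> D * exp (\<gamma> * (fst z - \<theta> * snd z))"
      using \<open>D' \<le> D\<close> by (intro mult_right_mono) auto
    then show ?thesis using K[OF that] by linarith
  qed
  have src: "\<bar>?L K L i j z - ?L K' L' i j z\<bar> \<le> C * D * exp (\<gamma> * (fst z - \<theta> * snd z))" if "z \<in> tri_dom" for z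
  proof -
    have "\<bar>?L K L i j z - ?L K' L' i j z\<bar>
        \<le> ((\<Sum>p=1..m. \<bar>\<sigma>mm p j\<bar>) + (\<Sum>k=1..n. \<bar>\<sigma>pm k j\<bar>)) * (D * exp (\<gamma> * (fst z - \<theta> * snd z)))"
      unfolding L_source_eq_K_source using K'' L that by (intro K_source_diff_le) auto
    also have "\<dots> \<le> C * (D * exp (\<gamma> * (fst z - \<theta> * snd z)))"
      using C \<open>0 \<le> D\<close> by (intro mult_right_mono) auto
    finally show ?thesis by (simp add: mult.assoc)
  qed
  define J where "J K L = (LBINT s:{0..nu_end \<mu> i j (fst z) (snd z)}.
        ?L K L i j (fst z + orient i j * \<mu> i * s, snd z + orient i j * \<mu> j * s))" for K L
  have "\<bar>J K L - J K' L'\<bar> \<le> C * D * exp (\<gamma> * (fst z - \<theta> * snd z)) / (\<gamma> * c)"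
    unfolding J_def
    using assms \<open>0 \<le> C\<close> nu_end_bounds[OF ij, of "fst z" "snd z"] L_characteristic_in_tri_dom[OF ij]
    by (intro char_integral_diff_le bounded_borel_on_L_source src) auto
  then have "\<bar>orient i j * (J K L - J K' L')\<bar> \<le> C * D * exp (\<gamma> * (fst z - \<theta> * snd z)) / (\<gamma> * c)"
    by (simp add: orient_def abs_mult)
  moreover have "\<bar>L_boundary n \<mu> lam \<sigma>mm q K i j (fst z) (snd z) - L_boundary n \<mu> lam \<sigma>mm q K' i j (fst z) (snd z)\<bar>
     \<le> C * D' * exp (\<gamma> * (fst z - \<theta> * snd z))"
    using assms by (intro L_boundary_diff_le) auto
  moreover have "L_map K L i j z - L_map K' L' i j z =
     (L_boundary n \<mu> lam \<sigma>mm q K i j (fst z) (snd z) - L_boundary n \<mu> lam \<sigma>mm q K' i j (fst z) (snd z)) -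
     orient i j * (J K L - J K' L')"
    unfolding L_map_def J_def by (simp only: right_diff_distrib)
  ultimately show ?thesis by linarith
qed

section \<open>All components as one scalar function, and the fixed point\<close>

definition K_part :: "(((nat \<times> nat) + (nat \<times> nat)) \<times> (real \<times> real) \<Rightarrow> real) \<Rightarrow> nat \<Rightarrow> nat \<Rightarrow> real \<times> real \<Rightarrow> real"
  where "K_part u i j z = u (Inl (i, j), z)"

definition L_part :: "(((nat \<times> nat) + (nat \<times> nat)) \<times> (real \<times> real) \<Rightarrow> real) \<Rightarrow> nat \<Rightarrow> nat \<Rightarrow> real \<times> real \<Rightarrow> real"
  where "L_part u i j z = u (Inr (i, j), z)"

text \<open>The contraction principle treats a single scalar function, so all components are merged
  into one function of a tagged index and a point; the tags \<open>Inl\<close> and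
  \<open>Inr\<close> let the weight distinguish \<open>K\<close> from \<open>L\<close>.\<close>

definition join :: "(nat \<Rightarrow> nat \<Rightarrow> real \<times> real \<Rightarrow> real) \<Rightarrow> (nat \<Rightarrow> nat \<Rightarrow> real \<times> real \<Rightarrow> real) \<Rightarrow>
    ((nat \<times> nat) + (nat \<times> nat)) \<times> (real \<times> real) \<Rightarrow> real"
  where "join K L = (\<lambda>(p, z). case p of Inl (i, j) \<Rightarrow> K i j z | Inr (i, j) \<Rightarrow> L i j z)"

definition indices :: "((nat \<times> nat) + (nat \<times> nat)) set"
  where "indices = ({1..m} \<times> {1..n}) <+> ({1..m} \<times> {1..m})"

lemma join_simps [simp]: "join K L (Inl (i, j), z) = K i j z" "join K L (Inr (i, j), z) = L i j z"
  by (simp_all add: join_def)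

lemma parts_join [simp]: "K_part (join K L) = K" "L_part (join K L) = L"
  by (intro ext, simp add: K_part_def L_part_def)+

lemma in_indices_iff [simp]:
  "Inl (i, j) \<in> indices \<longleftrightarrow> i \<in> {1..m} \<and> j \<in> {1..n}"
  "Inr (i, j) \<in> indices \<longleftrightarrow> i \<in> {1..m} \<and> j \<in> {1..m}"
  by (auto simp: indices_def)

lemma indices_cases:
  assumes "p \<in> indices"
  obtains (K) i j where "p = Inl (i, j)" "i \<in> {1..m}" "j \<in> {1..n}"
    | (L) i j where "p = Inr (i, j)" "i \<in> {1..m}" "j \<in> {1..m}"
  using assms by (auto simp: indices_def Plus_def)

lemma ball_indices:
  "(\<forall>p\<in>indices. Q p) \<longleftrightarrow>
    (\<forall>i\<in>{1..m}. \<forall>j\<in>{1..n}. Q (Inl (i, j))) \<and> (\<forall>i\<in>{1..m}. \<forall>j\<in>{1..m}. Q (Inr (i, j)))"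
  unfolding indices_def Plus_def by blast

lemma admissible_parts_iff:
  "admissible (K_part u) (L_part u) \<longleftrightarrow> (\<forall>p\<in>indices. bounded_borel_on tri_dom (\<lambda>z. u (p, z)))"
  by (simp add: admissible_def K_part_def[abs_def] L_part_def[abs_def] ball_indices)

definition kernel_map where
  "kernel_map u = join (K_map (K_part u) (L_part u)) (L_map (K_part u) (L_part u))"

theorem ex1_char_solution:
  obtains K L where "char_solution m n \<mu> lam \<sigma>pp \<sigma>pm \<sigma>mp \<sigma>mm q K L"
    "\<And>K' L'. char_solution m n \<mu> lam \<sigma>pp \<sigma>pm \<sigma>mp \<sigma>mm q K' L' \<Longrightarrow>
       (\<forall>i\<in>{1..m}. \<forall>j\<in>{1..n}. \<forall>z\<in>tri_dom. K' i j z = K i j z) \<and>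
       (\<forall>i\<in>{1..m}. \<forall>j\<in>{1..m}. \<forall>z\<in>tri_dom. L' i j z = L i j z)"
proof -
  obtain \<theta> c where \<theta>: "0 < \<theta>" "\<theta> < 1" and c: "0 < c"
    "\<And>i j. i \<in> {1..m} \<Longrightarrow> j \<in> {1..n} \<Longrightarrow> - \<mu> i - \<theta> * lam j \<le> - c"
    "\<And>i j. i \<in> {1..m} \<Longrightarrow> j \<in> {1..m} \<Longrightarrow> orient i j * \<mu> i - \<theta> * (orient i j * \<mu> j) \<le> - c"
    using obtain_decay_rate by blast
  \<comment> \<open>Besides dominating all coefficient sums, \<open>C\<close> is taken at least 1 so
    that \<open>D / (4 * C) \<le> D\<close> and
    \<open>1 / 4 + 1 / (8 * C) \<le> 1 / 2\<close>.\<close>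
  have "\<forall>\<^sub>F C in at_top.
      (\<forall>j\<in>{1..n}. (\<Sum>k=1..n. \<bar>\<sigma>pp k j\<bar>) + (\<Sum>p=1..m. \<bar>\<sigma>mp p j\<bar>) \<le> C) \<and>
      (\<forall>j\<in>{1..m}. (\<Sum>p=1..m. \<bar>\<sigma>mm p j\<bar>) + (\<Sum>k=1..n. \<bar>\<sigma>pm k j\<bar>) \<le> C) \<and>
      (\<forall>j\<in>{1..m}. 1 / \<mu> j * (\<Sum>r=1..n. \<bar>lam r * q r j\<bar>) \<le> C) \<and> 1 \<le> C"
    by (intro eventually_conj eventually_ball_finite ballI eventually_ge_at_top) auto
  from eventually_happens[OF this] obtain C where C: "1 \<le> C"
    "\<And>j. j \<in> {1..n} \<Longrightarrow> (\<Sum>k=1..n. \<bar>\<sigma>pp k j\<bar>) + (\<Sum>p=1..m. \<bar>\<sigma>mp p j\<bar>) \<le> C"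
    "\<And>j. j \<in> {1..m} \<Longrightarrow> (\<Sum>p=1..m. \<bar>\<sigma>mm p j\<bar>) + (\<Sum>k=1..n. \<bar>\<sigma>pm k j\<bar>) \<le> C"
    "\<And>j. j \<in> {1..m} \<Longrightarrow> 1 / \<mu> j * (\<Sum>r=1..n. \<bar>lam r * q r j\<bar>) \<le> C"
    by auto
  \<comment> \<open>The integral terms get the factor \<open>C / (\<gamma> * c) = 1 / (8 * C)\<close>, half of the scale \<open>1 / (4 * C)\<close> of \<open>K\<close> in \<open>W\<close>.\<close>
  define \<gamma> where "\<gamma> = 8 * C\<^sup>2 / c"
  have \<gamma>: "0 < \<gamma>" and \<gamma>c: "\<gamma> * c = 8 * C\<^sup>2" using C c by (auto simp: \<gamma>_def)
  define w where "w z = exp (\<gamma> * (fst z - \<theta> * snd z))" for z :: "real \<times> real"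
  define W where "W = (\<lambda>(p, z). (case p of Inl (_::nat \<times> nat) \<Rightarrow> 1 / (4 * C) | Inr (_::nat \<times> nat) \<Rightarrow> 1) * w z)"
  define S where "S = indices \<times> tri_dom"
  define M where "M = {u. admissible (K_part u) (L_part u)}"
  have w0: "0 \<le> w z" for z by (simp add: w_def)
  \<comment> \<open>The lower bound makes the weighted distance of two bounded families finite; the
    upper bound is the \<open>B\<close> of the contraction principle.\<close>
  have w1: "1 \<le> w z" and wB: "w z \<le> exp \<gamma>" if "z \<in> tri_dom" for z
  proof -
    have "0 \<le> snd z" "snd z \<le> fst z" "fst z \<le> 1" using that by (auto simp: tri_dom_def)
    moreover from this have "0 \<le> \<theta> * snd z" "\<theta> * snd z \<le> snd z"
      using \<theta> mult_right_mono[of \<theta> 1 "snd z"] by simp_all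
    ultimately have "0 \<le> fst z - \<theta> * snd z" "fst z - \<theta> * snd z \<le> 1" by auto
    then show "1 \<le> w z" "w z \<le> exp \<gamma>" using \<gamma> by (auto simp: w_def)
  qed
  obtain u where u: "u \<in> M" "\<And>z. z \<in> S \<Longrightarrow> kernel_map u z = u z"
    "\<And>v z. v \<in> M \<Longrightarrow> (\<And>z. z \<in> S \<Longrightarrow> kernel_map v z = v z) \<Longrightarrow> z \<in> S \<Longrightarrow> v z = u z"
  proof (rule weighted_contraction_fixpoint[of "\<lambda>_. 0" M kernel_map S W "exp \<gamma>"])
    show "(\<lambda>_. 0) \<in> M"
      by (simp add: M_def admissible_parts_iff bounded_borel_on_const)
    show "kernel_map u \<in> M" if "u \<in> M" for u
      using that bounded_borel_on_K_map[of "K_part u" "L_part u"] bounded_borel_on_L_map[of "K_part u" "L_part u"]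
      unfolding M_def kernel_map_def mem_Collect_eq parts_join by (auto simp: admissible_def)
    show "\<exists>D\<ge>0. \<forall>z\<in>S. \<bar>u z - v z\<bar> \<le> D * W z" if "u \<in> M" "v \<in> M" for u v
    proof -
      have "\<forall>\<^sub>F D in at_top. \<forall>z\<in>tri_dom. \<bar>u (p, z) - v (p, z)\<bar> \<le> D" if "p \<in> indices" for p
      proof -
        have "bounded_borel_on tri_dom (\<lambda>z. u (p, z))" "bounded_borel_on tri_dom (\<lambda>z. v (p, z))"
          using that \<open>u \<in> M\<close> \<open>v \<in> M\<close> by (auto simp: M_def admissible_parts_iff)
        then obtain A B where "\<forall>z\<in>tri_dom. \<bar>u (p, z)\<bar> \<le> A" "\<forall>z\<in>tri_dom. \<bar>v (p, z)\<bar> \<le> B"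
          by (auto simp: bounded_borel_on_iff)
        then have "\<forall>z\<in>tri_dom. \<bar>u (p, z) - v (p, z)\<bar> \<le> A + B"
          by (smt (verit))
        then show ?thesis
          by (intro eventually_mono[OF eventually_ge_at_top[of "A + B"]]) force
      qed
      then have "\<forall>\<^sub>F D in at_top. \<forall>p\<in>indices. \<forall>z\<in>tri_dom. \<bar>u (p, z) - v (p, z)\<bar> \<le> D"
        by (intro eventually_ball_finite[of indices] ballI) (simp_all add: indices_def)
      from eventually_conj[OF this eventually_ge_at_top[of 0]]
      have "\<forall>\<^sub>F D in at_top. (\<forall>p\<in>indices. \<forall>z\<in>tri_dom. \<bar>u (p, z) - v (p, z)\<bar> \<le> D) \<and> 0 \<le> D" .
      from eventually_happens[OF this] obtain D
        where D: "0 \<le> D" "\<And>p z. p \<in> indices \<Longrightarrow> z \<in> tri_dom \<Longrightarrow> \<bar>u (p, z) - v (p, z)\<bar> \<le> D"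
        by auto
      \<comment> \<open>The factor \<open>4 * C\<close> undoes the small scale of the
        \<open>K\<close> components in \<open>W\<close>.\<close>
      have "\<bar>u (p, z) - v (p, z)\<bar> \<le> (4 * C * D) * W (p, z)" if "p \<in> indices" "z \<in> tri_dom" for p z
      proof -
        have "D * 1 \<le> D * w z" using D w1[OF that(2)] by (intro mult_left_mono) auto
        moreover have "1 * (D * w z) \<le> 4 * C * (D * w z)"
          using D w0 C(1) by (intro mult_right_mono) auto
        ultimately show ?thesis using D(2)[OF that] C(1)
          by (auto simp: W_def split: sum.split)
      qed
      then show ?thesis using D C(1) by (intro exI[of _ "4 * C * D"]) (auto simp: S_def)
    qed
    show "\<forall>z\<in>S. \<bar>kernel_map u z - kernel_map v z\<bar> \<le> D / 2 * W z"
      if "u \<in> M" "v \<in> M" "0 \<le> D" and uv: "\<forall>z\<in>S. \<bar>u z - v z\<bar> \<le> D * W z" for u v D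
    proof -
      have adm: "admissible (K_part u) (L_part u)" "admissible (K_part v) (L_part v)"
        using that by (auto simp: M_def)
      have Kd: "\<bar>K_part u i k z - K_part v i k z\<bar> \<le> D / (4 * C) * w z"
        if "i \<in> {1..m}" "k \<in> {1..n}" "z \<in> tri_dom" for i k z
        using uv[rule_format, of "(Inl (i, k), z)"] that by (simp add: K_part_def W_def S_def)
      have Ld: "\<bar>L_part u i k z - L_part v i k z\<bar> \<le> D * w z"
        if "i \<in> {1..m}" "k \<in> {1..m}" "z \<in> tri_dom" for i k z
        using uv[rule_format, of "(Inr (i, k), z)"] that by (simp add: L_part_def W_def S_def)
      have DC: "0 \<le> D / (4 * C)" "D / (4 * C) \<le> D"
        using \<open>0 \<le> D\<close> C(1) mult_left_mono[of 1 "4 * C" D] by (auto simp: pos_divide_le_eq)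
      have Kd': "\<bar>K_part u i k z - K_part v i k z\<bar> \<le> D * w z"
        if "i \<in> {1..m}" "k \<in> {1..n}" "z \<in> tri_dom" for i k z
        using Kd[OF that] mult_right_mono[OF DC(2) w0, of z] by linarith
      have "\<bar>kernel_map u (p, z) - kernel_map v (p, z)\<bar> \<le> D / 2 * W (p, z)"
        if "p \<in> indices" and z: "z \<in> tri_dom" for p z
        using that(1)
      proof (cases rule: indices_cases)
        case (K i j)
        have "\<bar>K_map (K_part u) (L_part u) i j z - K_map (K_part v) (L_part v) i j z\<bar> \<le> C * D * w z / (\<gamma> * c)"
          unfolding w_def
          by (rule K_map_diff_le[OF adm K(2,3) z \<open>0 \<le> D\<close> \<gamma> c(1) c(2)[OF K(2,3)] C(2)[OF K(3)]])
            (use Kd' Ld K(2) in \<open>auto simp: w_def\<close>)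
        also have "\<dots> = D / 2 * (1 / (4 * C) * w z)"
          using C(1) by (simp add: \<gamma>c power2_eq_square)
        finally show ?thesis using K by (simp add: kernel_map_def W_def)
      next
        case (L i j)
        have "\<bar>L_map (K_part u) (L_part u) i j z - L_map (K_part v) (L_part v) i j z\<bar>
            \<le> C * (D / (4 * C)) * w z + C * D * w z / (\<gamma> * c)"
          unfolding w_def
          by (rule L_map_diff_le[OF adm L(2,3) z \<open>0 \<le> D\<close> DC(1) \<gamma> c(1) _ c(3)[OF L(2,3)] C(3,4)[OF L(3)]])
            (use Kd Ld L(2) \<theta> DC in \<open>auto simp: w_def\<close>)
        \<comment> \<open>The share \<open>1 / 4\<close> comes from the boundary term,
          \<open>1 / (8 * C)\<close> from the integral.\<close>
        also have "\<dots> = D * w z * (1 / 4 + 1 / (8 * C))"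
          using C(1) by (simp add: \<gamma>c power2_eq_square field_simps)
        also have "\<dots> \<le> D * w z * (1 / 2)"
          using C(1) \<open>0 \<le> D\<close> w0[of z] by (intro mult_left_mono mult_nonneg_nonneg) (auto simp: field_simps)
        finally show ?thesis using L by (simp add: kernel_map_def W_def)
      qed
      then show ?thesis by (auto simp: S_def)
    qed
    show "u \<in> M" if "\<And>k. U k \<in> M" and lim: "uniform_limit S U u sequentially" for U u
      unfolding M_def admissible_parts_iff mem_Collect_eq
    proof
      fix p assume p: "p \<in> indices"
      show "bounded_borel_on tri_dom (\<lambda>z. u (p, z))"
      proof (rule bounded_borel_on_uniform_limit[OF tri_dom_borel])
        show "uniform_limit tri_dom (\<lambda>k z. U k (p, z)) (\<lambda>z. u (p, z)) sequentially"
          using lim p unfolding uniform_limit_iff S_def by (auto elim!: eventually_mono)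
        show "bounded_borel_on tri_dom (\<lambda>z. U k (p, z))" for k
          using that(1)[of k] p by (simp add: M_def admissible_parts_iff)
      qed
    qed
    show "0 \<le> W z" if "z \<in> S" for z
      using w0 C(1) by (cases z) (simp add: W_def split: sum.split)
    show "W z \<le> exp \<gamma>" if "z \<in> S" for z
    proof -
      obtain p y where z: "z = (p, y)" "y \<in> tri_dom" using \<open>z \<in> S\<close> by (auto simp: S_def)
      have "1 / (4 * C) * w y \<le> 1 * w y" using C(1) w0 by (intro mult_right_mono) auto
      then show ?thesis using wB[OF z(2)] by (auto simp: W_def z split: sum.split)
    qed
  qed blast
  have sol_iff: "char_solution m n \<mu> lam \<sigma>pp \<sigma>pm \<sigma>mp \<sigma>mm q K L \<longleftrightarrow>
      join K L \<in> M \<and> (\<forall>z\<in>S. kernel_map (join K L) z = join K L z)" for K L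
  proof -
    have "(\<forall>z\<in>S. Q z) \<longleftrightarrow> (\<forall>p\<in>indices. \<forall>z\<in>tri_dom. Q (p, z))" for Q
      by (auto simp: S_def)
    then show ?thesis
      unfolding char_solution_iff
      by (simp add: M_def kernel_map_def ball_indices eq_commute[of "K_map _ _ _ _ _"] eq_commute[of "L_map _ _ _ _ _"])
  qed
  have ju: "join (K_part u) (L_part u) = u"
    by (intro ext) (auto simp: join_def K_part_def L_part_def split: sum.split)
  show thesis
  proof (rule that)
    show "char_solution m n \<mu> lam \<sigma>pp \<sigma>pm \<sigma>mp \<sigma>mm q (K_part u) (L_part u)"
      using u(1,2) by (simp add: sol_iff ju)
    fix K' L' assume "char_solution m n \<mu> lam \<sigma>pp \<sigma>pm \<sigma>mp \<sigma>mm q K' L'"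
    then have eq: "join K' L' z = u z" if "z \<in> S" for z
      using u(3)[of "join K' L'"] that by (auto simp: sol_iff)
    show "(\<forall>i\<in>{1..m}. \<forall>j\<in>{1..n}. \<forall>z\<in>tri_dom. K' i j z = K_part u i j z) \<and>
       (\<forall>i\<in>{1..m}. \<forall>j\<in>{1..m}. \<forall>z\<in>tri_dom. L' i j z = L_part u i j z)"
    proof (intro conjI ballI)
      fix i j z assume "i \<in> {1..m}" "j \<in> {1..n}" "z \<in> tri_dom"
      then show "K' i j z = K_part u i j z"
        using eq[of "(Inl (i, j), z)"] by (simp add: S_def K_part_def)
    next
      fix i j z assume "i \<in> {1..m}" "j \<in> {1..m}" "z \<in> tri_dom"
      then show "L' i j z = L_part u i j z"
        using eq[of "(Inr (i, j), z)"] by (simp add: S_def L_part_def)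
    qed
  qed
qed

end

theorem mainTheorem2:
  fixes m n :: nat
    and \<mu> lam :: "nat \<Rightarrow> real"
    and \<sigma>pp \<sigma>pm \<sigma>mp \<sigma>mm q :: "nat \<Rightarrow> nat \<Rightarrow> real"
  assumes "1 \<le> m"
    and "strict_mono_on {1..m} (\<lambda>i. - \<mu> i)"
    and "\<forall>i\<in>{1..m}. - \<mu> i < 0"
    and "\<forall>j\<in>{1..n}. 0 < lam j"
    and "mono_on {1..n} lam"
    and "\<forall>j\<in>{1..m}. \<sigma>mm j j = 0"
  shows "\<exists>K L. char_solution m n \<mu> lam \<sigma>pp \<sigma>pm \<sigma>mp \<sigma>mm q K L \<and>
           (\<forall>K' L'. char_solution m n \<mu> lam \<sigma>pp \<sigma>pm \<sigma>mp \<sigma>mm q K' L' \<longrightarrow>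
              (\<forall>i\<in>{1..m}. \<forall>j\<in>{1..n}. \<forall>z\<in>tri_dom. K' i j z = K i j z) \<and>
              (\<forall>i\<in>{1..m}. \<forall>j\<in>{1..m}. \<forall>z\<in>tri_dom. L' i j z = L i j z)) \<and>
           (\<forall>i\<in>{1..m}. \<forall>j\<in>{1..n}. traces_Linf (K i j)) \<and>
           (\<forall>i\<in>{1..m}. \<forall>j\<in>{1..m}. traces_Linf (L i j))"
proof -
  interpret kernel_system m n \<mu> lam \<sigma>pp \<sigma>pm \<sigma>mp \<sigma>mm q
  proof
    show "0 < \<mu> i" if "i \<in> {1..m}" for i using assms(3) that by auto
    show "\<mu> j < \<mu> i" if "i \<in> {1..m}" "j \<in> {1..m}" "i < j" for i j
      using strict_mono_onD[OF assms(2) that] by simp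
    show "0 < lam j" if "j \<in> {1..n}" for j using assms(4) that by auto
  qed
  obtain K L where sol: "char_solution m n \<mu> lam \<sigma>pp \<sigma>pm \<sigma>mp \<sigma>mm q K L"
    and unique: "\<And>K' L'. char_solution m n \<mu> lam \<sigma>pp \<sigma>pm \<sigma>mp \<sigma>mm q K' L' \<Longrightarrow>
       (\<forall>i\<in>{1..m}. \<forall>j\<in>{1..n}. \<forall>z\<in>tri_dom. K' i j z = K i j z) \<and>
       (\<forall>i\<in>{1..m}. \<forall>j\<in>{1..m}. \<forall>z\<in>tri_dom. L' i j z = L i j z)"
    using ex1_char_solution by blast
  \<comment> \<open>Being bounded Borel is part of being a solution, so the traces need no further
    use of the equations.\<close>
  from sol have "admissible K L" by (simp add: char_solution_iff)
  then have "\<forall>i\<in>{1..m}. \<forall>j\<in>{1..n}. traces_Linf (K i j)" "\<forall>i\<in>{1..m}. \<forall>j\<in>{1..m}. traces_Linf (L i j)"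
    by (auto simp: admissible_def intro: traces_Linf_if_bounded_borel_on)
  with sol unique show ?thesis by blast
qed

end
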